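(* Let $(\omega(t))_{t\in\mathbb R}$ be a stationary continuous-time Markov process on a state space $S$ whose generator $Q$ is reversible with respect to a probability measure $\pi$ and has spectral gap $\delta>0$. Let $k\in\mathbb N^+$, and let $a_i,b_i$ ($0\le i\le k$) satisfy $a_i<b_i$ and $b_i\le a_{i+1}$ for $0\le i\le k-1$, where $a_0=-\infty$ and $b_k=\infty$ are permitted. Let $\mathcal A_0,\dots,\mathcal A_k\subseteq\Omega$ with each $\mathcal A_i$ measurable with respect to $\mathcal F_{[a_i,b_i]}$. Then $$\mathbf P\Big[\bigcap_{i=0}^k\mathcal A_i\Big]\le\sqrt{\mathbf P[\mathcal A_0]}\sqrt{\mathbf P[\mathcal A_k]}\prod_{i=0}^{k-1}\Big[\sqrt{\mathbf P[\mathcal A_i]}\sqrt{\mathbf P[\mathcal A_{i+1}]}+e^{-\delta(a_{i+1}-b_i)}\Big(1-\sqrt{\mathbf P[\mathcal A_i]}\sqrt{\mathbf P[\mathcal A_{i+1}]}\Big)\Big].$$ In particular, if $\mathcal A$ is measurable with respect to $\mathcal F_{[a,b]}$ with $\mathbf P[\mathcal A]=p$, $s_0<s_1<\dots<s_k$ are reals, and $t_i:=s_{i+1}-s_i-(b-a)\ge0$ for all $0\le i<k$, then $$\mathbf P\big[(\omega(t+s_i))_{t\in[a,b]}\in\mathcal A\text{ for } i=0,1,\dots,k\big]\le p\prod_{i=0}^{k-1}\big(p+e^{-\delta t_i}(1-p)\big).$$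
   Context: The semigroup is $T_t=e^{tQ}$; $Q$ is self-adjoint and negative semidefinite on $L^2(S,\pi)$, and "spectral gap $\delta>0$" means the spectrum of $Q$ is contained in $\{0\}\cup(-\infty,-\delta]$ with $0$ having the constants as eigenspace. $\Omega$ is the space of paths $\omega:\mathbb R\to S$ of the process under its stationary law $\mathbf P$. For $I\subseteq\mathbb R$, $\mathcal F_I$ is the $\sigma$-algebra generated by $\{\omega(t):t\in I\}$. *)

theory Defs
  imports "HOL-Probability.Probability"
begin

definition L2 :: "'s measure \<Rightarrow> ('s \<Rightarrow> real) \<Rightarrow> bool" where
  "L2 \<pi> f \<longleftrightarrow> f \<in> borel_measurable \<pi> \<and> integrable \<pi> (\<lambda>x. (f x)^2)"

definition L2norm :: "'s measure \<Rightarrow> ('s \<Rightarrow> real) \<Rightarrow> real" where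
  "L2norm \<pi> f = sqrt (\<integral>x. (f x)^2 \<partial>\<pi>)"

abbreviation path_space :: "'s measure \<Rightarrow> (real \<Rightarrow> 's) measure" where
  "path_space \<pi> \<equiv> PiM (UNIV :: real set) (\<lambda>_. \<pi>)"

definition coord_sigma :: "(real \<Rightarrow> 's) measure \<Rightarrow> 's measure \<Rightarrow> real set \<Rightarrow> (real \<Rightarrow> 's) set set" where
  "coord_sigma P \<pi> I = sigma_sets (space P)
     (\<Union>t\<in>I. {(\<lambda>\<omega>. \<omega> t) -` B \<inter> space P | B. B \<in> sets \<pi>})"

definition stationary :: "(real \<Rightarrow> 's) measure \<Rightarrow> 's measure \<Rightarrow> bool" where
  "stationary P \<pi> \<longleftrightarrow> (\<forall>t. distr P \<pi> (\<lambda>\<omega>. \<omega> t) = \<pi>)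
      \<and> (\<forall>s. distr P P (\<lambda>\<omega> t. \<omega> (t + s)) = P)"

text \<open>Markov property with transition semigroup T (acting on L2(pi)):
  E[f(omega(t+s)) | F_(-inf,t]] = (T s f)(omega(t)).\<close>
definition markov :: "(real \<Rightarrow> 's) measure \<Rightarrow> 's measure \<Rightarrow> (real \<Rightarrow> ('s \<Rightarrow> real) \<Rightarrow> ('s \<Rightarrow> real)) \<Rightarrow> bool" where
  "markov P \<pi> T \<longleftrightarrow> (\<forall>t s f. 0 \<le> s \<longrightarrow> L2 \<pi> f \<longrightarrow>
      (\<forall>E\<in>coord_sigma P \<pi> {..t}.
         (\<integral>\<omega>. indicator E \<omega> * f (\<omega> (t + s)) \<partial>P) = (\<integral>\<omega>. indicator E \<omega> * T s f (\<omega> t) \<partial>P)))"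

text \<open>T is a strongly continuous semigroup of operators on L2(pi) which is symmetric
  (reversibility); its generator Q is then self-adjoint and negative semidefinite,
  and T t = exp(t Q).\<close>
definition symmetric_C0 :: "'s measure \<Rightarrow> (real \<Rightarrow> ('s \<Rightarrow> real) \<Rightarrow> ('s \<Rightarrow> real)) \<Rightarrow> bool" where
  "symmetric_C0 \<pi> T \<longleftrightarrow>
     (\<forall>t f. 0 \<le> t \<longrightarrow> L2 \<pi> f \<longrightarrow> L2 \<pi> (T t f))
   \<and> (\<forall>t f g. 0 \<le> t \<longrightarrow> L2 \<pi> f \<longrightarrow> L2 \<pi> g \<longrightarrow>
        (\<integral>x. T t f x * g x \<partial>\<pi>) = (\<integral>x. f x * T t g x \<partial>\<pi>))
   \<and> (\<forall>f. L2 \<pi> f \<longrightarrow> ((\<lambda>h. L2norm \<pi> (\<lambda>x. T h f x - f x)) \<longlongrightarrow> 0) (at_right 0))"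

definition is_generator :: "'s measure \<Rightarrow> (real \<Rightarrow> ('s \<Rightarrow> real) \<Rightarrow> ('s \<Rightarrow> real)) \<Rightarrow> ('s \<Rightarrow> real) \<Rightarrow> ('s \<Rightarrow> real) \<Rightarrow> bool" where
  "is_generator \<pi> T f g \<longleftrightarrow> L2 \<pi> f \<and> L2 \<pi> g \<and>
     ((\<lambda>h. L2norm \<pi> (\<lambda>x. (T h f x - f x) / h - g x)) \<longlongrightarrow> 0) (at_right 0)"

definition in_resolvent :: "'s measure \<Rightarrow> (real \<Rightarrow> ('s \<Rightarrow> real) \<Rightarrow> ('s \<Rightarrow> real)) \<Rightarrow> real \<Rightarrow> bool" where
  "in_resolvent \<pi> T lam \<longleftrightarrow>
     (\<forall>g. L2 \<pi> g \<longrightarrow> (\<exists>f q. is_generator \<pi> T f q \<and> (AE x in \<pi>. lam * f x - q x = g x)))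
   \<and> (\<exists>C. \<forall>f q. is_generator \<pi> T f q \<longrightarrow> L2norm \<pi> f \<le> C * L2norm \<pi> (\<lambda>x. lam * f x - q x))"

definition spectral_gap :: "'s measure \<Rightarrow> (real \<Rightarrow> ('s \<Rightarrow> real) \<Rightarrow> ('s \<Rightarrow> real)) \<Rightarrow> real \<Rightarrow> bool" where
  "spectral_gap \<pi> T \<delta> \<longleftrightarrow>
     (\<forall>lam. (0 < lam \<or> (- \<delta> < lam \<and> lam < 0)) \<longrightarrow> in_resolvent \<pi> T lam)
   \<and> (\<forall>f q. is_generator \<pi> T f q \<longrightarrow> ((AE x in \<pi>. q x = 0) \<longleftrightarrow> (\<exists>c. AE x in \<pi>. f x = c)))"

end

(* Write c_i = exp(-delta (a_{i+1} - b_i)). The spectral gap says that the semigroup over the i-th gap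
   is (1 - c_i) Pi + c_i S_i, where Pi averages against pi and S_i is a contraction of L2(pi).
   Let u_i be the conditional probability of A_0, ..., A_i given the state at time b_i. Inserting the
   decomposition and using the Markov property and Cauchy-Schwarz, the pair of bounds
   ||u_i|| <= W_i and P(A_0, ..., A_i) <= sqrt(P(A_i)) W_i propagates from i to i + 1 when W_i is
   multiplied by the i-th factor of the product; W_0 = sqrt(P(A_0)).

   The contraction rate exp(-delta t) on mean-zero functions is obtained from the resolvent form of
   the spectral gap without the spectral theorem: the resolvent set gives Q (Q + delta) >= 0 as a
   quadratic form, which is a differential inequality along the semigroup. *)
theory Submission
  imports Defs
begin

subsection \<open>The space of square integrable functions\<close>

text \<open>\<open>L2\<close> is a predicate on functions, not a space of classes, and
  \<open>symmetric_C0\<close> contains neither linearity nor the semigroup law nor contractivity of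
  \<open>T\<close>. So identities for \<open>T\<close> are weak, tested against functions in
  \<open>L2\<close>, and norm bounds come from duality; linearity comes from symmetry, the other
  laws from two-time correlations of the process. Two bounds travel along the chain because the two
  parts of the semigroup see different quantities: averaging sees only the probability of the past
  event, the contraction only the norm of its density. Writing the former as sqrt(P(A_i)) W_i lets
  W_i be factored out of both. The differential inequality needs vectors in the domain of Q, so a
  general f is written as x - Q x with the resolvent at 1. This costs constants, whereas the product
  needs the rate with constant exactly one; log-convexity of the semigroup restores it. The
  inequality is also blind to the kernel of Q, as Q (Q + delta) vanishes there; that mean-zero
  functions tend to 0 at all needs a separate ergodic argument.\<close>

definition ip :: "'s measure \<Rightarrow> ('s \<Rightarrow> real) \<Rightarrow> ('s \<Rightarrow> real) \<Rightarrow> real" where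
  "ip M f g = (\<integral>x. f x * g x \<partial>M)"

lemma L2_meas [measurable_dest]: "L2 M f \<Longrightarrow> f \<in> borel_measurable M"
  by (simp add: L2_def)

lemma L2_integrable_sq: "L2 M f \<Longrightarrow> integrable M (\<lambda>x. (f x)^2)"
  by (simp add: L2_def)

lemma L2_integrable_mult:
  assumes "L2 M f" "L2 M g"
  shows "integrable M (\<lambda>x. f x * g x)"
proof (rule Bochner_Integration.integrable_bound)
  show "integrable M (\<lambda>x. (f x)^2 + (g x)^2)"
    using assms by (simp add: L2_def)
  have "\<bar>a * b\<bar> \<le> a^2 + b^2" for a b :: real
  proof -
    have "2 * (\<bar>a\<bar> * \<bar>b\<bar>) \<le> a^2 + b^2"
      using sum_squares_bound[of "\<bar>a\<bar>" "\<bar>b\<bar>"] by (simp add: mult.assoc)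
    moreover have "0 \<le> \<bar>a\<bar> * \<bar>b\<bar>" by simp
    ultimately show ?thesis by (simp only: abs_mult)
  qed
  then show "AE x in M. norm (f x * g x) \<le> norm ((f x)^2 + (g x)^2)"
    by simp
qed (use assms[THEN L2_meas] in measurable)

lemma L2_add [simp, intro]:
  assumes "L2 M f" "L2 M g"
  shows "L2 M (\<lambda>x. f x + g x)"
  unfolding L2_def
proof
  show "integrable M (\<lambda>x. (f x + g x)^2)"
    using L2_integrable_mult[OF assms] assms
    by (simp add: L2_def power2_sum mult.assoc)
qed (use assms[THEN L2_meas] in measurable)

lemma L2_scale [simp, intro]: "L2 M f \<Longrightarrow> L2 M (\<lambda>x. c * f x)"
  by (simp add: L2_def power_mult_distrib borel_measurable_times)

lemma L2_diff [simp, intro]: "L2 M f \<Longrightarrow> L2 M g \<Longrightarrow> L2 M (\<lambda>x. f x - g x)"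
  using L2_add[of M f "\<lambda>x. (-1) * g x"] L2_scale[of M g "-1"] by simp

lemma L2_divide [simp, intro]: "L2 M f \<Longrightarrow> L2 M (\<lambda>x. f x / c)"
  by (simp add: L2_def power_divide borel_measurable_divide)

lemma ip_commute: "ip M f g = ip M g f"
  by (simp add: ip_def mult.commute)

lemma ip_add_left: "L2 M f \<Longrightarrow> L2 M g \<Longrightarrow> L2 M h \<Longrightarrow> ip M (\<lambda>x. f x + g x) h = ip M f h + ip M g h"
  by (simp add: ip_def distrib_right L2_integrable_mult)

lemma ip_diff_left: "L2 M f \<Longrightarrow> L2 M g \<Longrightarrow> L2 M h \<Longrightarrow> ip M (\<lambda>x. f x - g x) h = ip M f h - ip M g h"
  by (simp add: ip_def left_diff_distrib L2_integrable_mult)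

lemma ip_scale_left: "ip M (\<lambda>x. c * f x) h = c * ip M f h"
  by (simp add: ip_def mult.assoc)

lemma ip_divide_left: "ip M (\<lambda>x. f x / c) h = ip M f h / c"
  by (simp add: ip_def)

lemma ip_add_right: "L2 M f \<Longrightarrow> L2 M g \<Longrightarrow> L2 M h \<Longrightarrow> ip M h (\<lambda>x. f x + g x) = ip M h f + ip M h g"
  by (simp add: ip_add_left ip_commute[of M h])

lemma ip_diff_right: "L2 M f \<Longrightarrow> L2 M g \<Longrightarrow> L2 M h \<Longrightarrow> ip M h (\<lambda>x. f x - g x) = ip M h f - ip M h g"
  by (simp add: ip_diff_left ip_commute[of M h])

lemma ip_scale_right: "ip M h (\<lambda>x. c * f x) = c * ip M h f"
  by (simp add: ip_scale_left ip_commute[of M h])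

lemma ip_divide_right: "ip M h (\<lambda>x. f x / c) = ip M h f / c"
  by (simp add: ip_divide_left ip_commute[of M h])

lemma ip_const_left: "ip M (\<lambda>_. c) f = c * ip M f (\<lambda>_. 1)"
  by (simp add: ip_def mult.commute)

lemma ip_const_right: "ip M f (\<lambda>_. c) = c * ip M f (\<lambda>_. 1)"
  by (simp add: ip_def)

lemma L2_uminus [simp, intro]: "L2 M f \<Longrightarrow> L2 M (\<lambda>x. - f x)"
  using L2_scale[of M f "-1"] by simp

lemma ip_uminus_left: "ip M (\<lambda>x. - f x) h = - ip M f h"
  by (simp add: ip_def)

lemma ip_uminus_right: "ip M h (\<lambda>x. - f x) = - ip M h f"
  by (simp add: ip_def)

lemmas ip_simps = ip_uminus_left ip_uminus_right ip_add_left ip_diff_left ip_scale_left ip_divide_left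
  ip_add_right ip_diff_right ip_scale_right ip_divide_right

lemma ip_cong_AE:
  assumes "AE x in M. f x = g x" "L2 M f" "L2 M g" "L2 M h"
  shows "ip M f h = ip M g h"
  unfolding ip_def
  by (rule integral_cong_AE) (use assms in \<open>auto simp: L2_def\<close>)

lemma ip_self_nonneg: "0 \<le> ip M f f"
  unfolding ip_def by (rule Bochner_Integration.integral_nonneg) simp

lemma L2norm_ip: "L2norm M f = sqrt (ip M f f)"
  by (simp add: L2norm_def ip_def power2_eq_square)

lemma L2norm_nonneg [simp]: "0 \<le> L2norm M f"
  by (simp add: L2norm_ip ip_self_nonneg)

lemma L2norm_sq: "(L2norm M f)^2 = ip M f f"
  by (simp add: L2norm_ip ip_self_nonneg)

lemma L2norm_divide: "L2norm M (\<lambda>x. f x / c) = L2norm M f / \<bar>c\<bar>"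
  by (simp add: L2norm_ip ip_divide_left ip_divide_right real_sqrt_divide)

text \<open>Serves twice: for Cauchy-Schwarz, and in \<open>gap_eps\<close> for a semidefinite form
  other than the inner product.\<close>

lemma discriminant_bound:
  fixes a b c :: real
  assumes "\<And>t. 0 \<le> a + 2 * t * b + t^2 * c" "0 \<le> c"
  shows "b^2 \<le> a * c"
proof (cases "c = 0")
  case True
  have "b = 0"
  proof (rule ccontr)
    assume "b \<noteq> 0"
    \<comment> \<open>With \<open>c = 0\<close> the quadratic is affine in \<open>t\<close>; this
      \<open>t\<close> is where it takes the value -1.\<close>
    then have "a + 2 * (-(a+1)/(2*b)) * b + (-(a+1)/(2*b))^2 * c = -1"
      using True by (simp add: field_simps)
    with assms(1)[of "-(a+1)/(2*b)"] show False by simp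
  qed
  then show ?thesis using True by simp
next
  case False
  then have c: "c > 0" using assms(2) by simp
  have "0 \<le> a + 2 * (-b/c) * b + (-b/c)^2 * c" by (rule assms(1))
  also have "\<dots> = a - b^2/c"
    using c by (simp add: field_simps power2_eq_square)
  finally show ?thesis using c by (simp add: field_simps)
qed

lemma ip_Cauchy_Schwarz_sq:
  assumes "L2 M f" "L2 M g"
  shows "(ip M f g)^2 \<le> ip M f f * ip M g g"
proof (rule discriminant_bound)
  fix t
  have "0 \<le> ip M (\<lambda>x. f x + t * g x) (\<lambda>x. f x + t * g x)" by (rule ip_self_nonneg)
  also have "\<dots> = ip M f f + 2 * t * ip M f g + t^2 * ip M g g"
    using assms by (simp add: ip_simps ip_commute[of M g f] algebra_simps power2_eq_square)
  finally show "0 \<le> ip M f f + 2 * t * ip M f g + t^2 * ip M g g" .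
qed (rule ip_self_nonneg)

lemma ip_Cauchy_Schwarz:
  assumes "L2 M f" "L2 M g"
  shows "\<bar>ip M f g\<bar> \<le> L2norm M f * L2norm M g"
  using ip_Cauchy_Schwarz_sq[OF assms]
  by (metis L2norm_ip real_sqrt_abs real_sqrt_le_mono real_sqrt_mult)

lemma ip_le_norms: "L2 M f \<Longrightarrow> L2 M g \<Longrightarrow> ip M f g \<le> L2norm M f * L2norm M g"
  using ip_Cauchy_Schwarz by fastforce

text \<open>Test against \<open>f\<close> itself. Most norm estimates for \<open>T\<close> go
  through this lemma, since under the inner product \<open>T t\<close> can be moved to the test
  function.\<close>

lemma L2norm_le_dual:
  assumes "L2 M f" "\<And>g. L2 M g \<Longrightarrow> ip M f g \<le> C * L2norm M g" "0 \<le> C"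
  shows "L2norm M f \<le> C"
proof (cases "L2norm M f = 0")
  case False
  then have pos: "0 < L2norm M f" by (simp add: less_le)
  have "L2norm M f * L2norm M f \<le> C * L2norm M f"
    using assms(2)[OF assms(1)] by (metis L2norm_sq power2_eq_square)
  then show ?thesis using pos by simp
qed (use assms in simp)

lemma L2norm_triangle:
  assumes "L2 M f" "L2 M g"
  shows "L2norm M (\<lambda>x. f x + g x) \<le> L2norm M f + L2norm M g"
proof (rule L2norm_le_dual)
  fix h assume h: "L2 M h"
  show "ip M (\<lambda>x. f x + g x) h \<le> (L2norm M f + L2norm M g) * L2norm M h"
    using ip_le_norms[OF assms(1) h] ip_le_norms[OF assms(2) h] assms h
    by (simp add: ip_simps distrib_right)
qed (use assms in auto)

lemma L2norm_cong_AE: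
  assumes "AE x in M. f x = g x" "f \<in> borel_measurable M" "g \<in> borel_measurable M"
  shows "L2norm M f = L2norm M g"
  unfolding L2norm_def
  by (rule arg_cong[where f=sqrt], rule integral_cong_AE) (use assms in auto)

section \<open>Completeness of L2 over a probability space\<close>

context prob_space
begin

lemma L2_const [simp, intro]: "L2 M (\<lambda>_. c)"
  by (simp add: L2_def)

lemma ip_one_one [simp]: "ip M (\<lambda>_. 1) (\<lambda>_. 1) = 1"
  by (simp add: ip_def prob_space)

lemma L2_integrable: "L2 M f \<Longrightarrow> integrable M f"
  using L2_integrable_mult[OF _ L2_const, of f 1] by simp

lemma L2_bounded:
  assumes "f \<in> borel_measurable M" "\<And>x. \<bar>f x\<bar> \<le> B"
  shows "L2 M f"
  unfolding L2_def
proof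
  show "integrable M (\<lambda>x. (f x)^2)"
  proof (rule integrable_const_bound)
    show "AE x in M. norm ((f x)^2) \<le> B^2"
      using power_mono[OF assms(2) abs_ge_zero, where n = 2] by simp
  qed (use assms in simp)
qed (rule assms)

text \<open>Riesz-Fischer: a subsequence with geometrically small increments converges almost
  everywhere, and Fatou's lemma turns this into convergence of the whole sequence in norm.\<close>

lemma L2_complete:
  assumes L2: "\<And>n::nat. L2 M (z n)"
    and Cauchy: "\<And>e. e > 0 \<Longrightarrow> \<exists>N. \<forall>m\<ge>N. \<forall>n\<ge>N. L2norm M (\<lambda>x. z m x - z n x) \<le> e"
  shows "\<exists>w. L2 M w \<and> (\<lambda>n. L2norm M (\<lambda>x. z n x - w x)) \<longlonglongrightarrow> 0"
proof -
  have "\<forall>k. \<exists>N. \<forall>m\<ge>N. \<forall>n\<ge>N. L2norm M (\<lambda>x. z m x - z n x) \<le> (1/2)^k"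
    by (intro allI Cauchy) simp
  then obtain N where N: "\<And>k m n. m \<ge> N k \<Longrightarrow> n \<ge> N k \<Longrightarrow> L2norm M (\<lambda>x. z m x - z n x) \<le> (1/2)^k"
    by metis
  \<comment> \<open>The sum makes \<open>r\<close> monotone and at least \<open>N n\<close>; the
    extra \<open>n\<close> makes it unbounded.\<close>
  define r where "r n = (\<Sum>i\<le>n. N i) + n" for n
  have rN: "r n \<ge> N n" for n
    unfolding r_def using member_le_sum[of n "{..n}" N] by simp
  have rS: "r (Suc n) \<ge> r n" for n
    unfolding r_def by simp
  have [measurable]: "z n \<in> borel_measurable M" for n
    using L2 by (simp add: L2_def)
  define d where "d n x = \<bar>z (r (Suc n)) x - z (r n) x\<bar>" for n x
  have [measurable]: "d n \<in> borel_measurable M" for n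
    unfolding d_def[abs_def] by measurable
  have d_L2: "L2 M (d n)" for n
    using L2_diff[OF L2[of "r (Suc n)"] L2[of "r n"]] unfolding L2_def d_def[abs_def] by simp
  \<comment> \<open>On a probability space the L1 norm is at most the L2 norm.\<close>
  have d_int: "(\<integral>\<^sup>+x. ennreal (d n x) \<partial>M) \<le> ennreal ((1/2)^n)" for n
  proof -
    have "(\<integral>\<^sup>+x. ennreal (d n x) \<partial>M) = ennreal (\<integral>x. d n x \<partial>M)"
      by (rule nn_integral_eq_integral[OF L2_integrable[OF d_L2]]) (simp add: d_def)
    also have "(\<integral>x. d n x \<partial>M) = ip M (d n) (\<lambda>_. 1)"
      by (simp add: ip_def)
    also have "\<dots> \<le> L2norm M (d n) * L2norm M (\<lambda>_. 1)"
      by (rule ip_le_norms[OF d_L2 L2_const])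
    also have "L2norm M (\<lambda>_. 1) = 1" by (simp add: L2norm_ip)
    also have "L2norm M (d n) = L2norm M (\<lambda>x. z (r (Suc n)) x - z (r n) x)"
      by (simp add: L2norm_def d_def)
    also have "\<dots> \<le> (1/2)^n"
      using N[of n "r (Suc n)" "r n"] rN[of n] rS[of n] by simp
    finally show ?thesis by (simp add: ennreal_leI)
  qed
  have "(\<integral>\<^sup>+x. (\<Sum>n. ennreal (d n x)) \<partial>M) = (\<Sum>n. \<integral>\<^sup>+x. ennreal (d n x) \<partial>M)"
    by (rule nn_integral_suminf) simp
  also have "\<dots> \<le> (\<Sum>n. ennreal ((1/2)^n))"
    by (intro suminf_le d_int) auto
  also have "\<dots> = ennreal 2"
  proof -
    have "(\<Sum>n. ennreal ((1/2)^n)) = ennreal (\<Sum>n. (1/2)^n)"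
      by (rule suminf_ennreal2) (auto intro: summable_geometric)
    also have "(\<Sum>n. (1/2)^n) = (2::real)"
      using suminf_geometric[of "1/2::real"] by simp
    finally show ?thesis .
  qed
  finally have fin: "(\<integral>\<^sup>+x. (\<Sum>n. ennreal (d n x)) \<partial>M) \<noteq> \<infinity>"
    by (metis ennreal_neq_top infinity_ennreal_def top_unique)
  have "AE x in M. (\<Sum>n. ennreal (d n x)) \<noteq> \<infinity>"
    by (rule nn_integral_PInf_AE[OF _ fin]) measurable
  then have AE_conv: "AE x in M. convergent (\<lambda>n. z (r n) x)"
  proof eventually_elim
    case (elim x)
    have "summable (\<lambda>n. d n x)"
      by (rule summable_suminf_not_top) (use elim in \<open>auto simp: d_def\<close>)
    then have "summable (\<lambda>n. z (r (Suc n)) x - z (r n) x)"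
      unfolding d_def by (rule summable_rabs_cancel)
    then have "convergent (\<lambda>n. \<Sum>i<n. z (r (Suc i)) x - z (r i) x)"
      by (simp add: summable_iff_convergent)
    then have "convergent (\<lambda>n. z (r n) x - z (r 0) x)"
      by (simp add: sum_lessThan_telescope[where f="\<lambda>n. z (r n) x"])
    then show ?case
      by (metis convergent_diff_const_right_iff)
  qed
  define w where "w x = lim (\<lambda>n. z (r n) x)" for x
  have [measurable]: "w \<in> borel_measurable M"
    unfolding w_def[abs_def] by measurable
  have AE_lim: "AE x in M. (\<lambda>n. z (r n) x) \<longlonglongrightarrow> w x"
    using AE_conv by eventually_elim (simp add: w_def convergent_LIMSEQ_iff)
  \<comment> \<open>Fatou's lemma along the subsequence passes the Cauchy bound for a fixed
    \<open>m\<close> to the limit \<open>w\<close>.\<close>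
  have key: "(\<integral>\<^sup>+x. ennreal ((z m x - w x)^2) \<partial>M) \<le> ennreal (e^2)"
    if e: "e > 0" and H: "\<And>n. n \<ge> K \<Longrightarrow> L2norm M (\<lambda>x. z m x - z n x) \<le> e" for m e K
  proof -
    have "(\<integral>\<^sup>+x. ennreal ((z m x - w x)^2) \<partial>M)
        = (\<integral>\<^sup>+x. liminf (\<lambda>n. ennreal ((z m x - z (r n) x)^2)) \<partial>M)"
    proof (rule nn_integral_cong_AE)
      show "AE x in M. ennreal ((z m x - w x)^2) = liminf (\<lambda>n. ennreal ((z m x - z (r n) x)^2))"
        using AE_lim
      proof eventually_elim
        case (elim x)
        have "(\<lambda>n. ennreal ((z m x - z (r n) x)^2)) \<longlonglongrightarrow> ennreal ((z m x - w x)^2)"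
          by (intro tendsto_intros elim)
        from lim_imp_Liminf[OF _ this] show ?case by simp
      qed
    qed
    also have "\<dots> \<le> liminf (\<lambda>n. \<integral>\<^sup>+x. ennreal ((z m x - z (r n) x)^2) \<partial>M)"
      by (rule nn_integral_liminf) measurable
    also have "\<dots> \<le> ennreal (e^2)"
    proof (rule Liminf_le)
      show "\<forall>\<^sub>F n in sequentially. (\<integral>\<^sup>+x. ennreal ((z m x - z (r n) x)^2) \<partial>M) \<le> ennreal (e^2)"
        using eventually_ge_at_top[of K]
      proof eventually_elim
        case (elim n)
        then have "r n \<ge> K" unfolding r_def by simp
        then have "(L2norm M (\<lambda>x. z m x - z (r n) x))^2 \<le> e^2"
          using H by (intro power_mono) auto
        then have "(\<integral>x. (z m x - z (r n) x)^2 \<partial>M) \<le> e^2"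
          unfolding L2norm_sq by (simp add: ip_def power2_eq_square)
        then show ?case
          using nn_integral_eq_integral[OF L2_integrable_sq[OF L2_diff[OF L2[of m] L2[of "r n"]]]]
          by (simp add: ennreal_leI)
      qed
    qed simp
    finally show ?thesis .
  qed
  have key2: "L2 M (\<lambda>x. z m x - w x) \<and> L2norm M (\<lambda>x. z m x - w x) \<le> e"
    if e: "e > 0" and H: "\<And>n. n \<ge> K \<Longrightarrow> L2norm M (\<lambda>x. z m x - z n x) \<le> e" for m e K
  proof
    have int: "integrable M (\<lambda>x. (z m x - w x)^2)"
    proof (rule integrableI_bounded)
      show "(\<integral>\<^sup>+x. ennreal (norm ((z m x - w x)^2)) \<partial>M) < \<infinity>"
        using order_le_less_trans[OF key[OF e H] ennreal_less_top] by simp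
    qed measurable
    show "L2 M (\<lambda>x. z m x - w x)" using int by (simp add: L2_def)
    have "ennreal (\<integral>x. (z m x - w x)^2 \<partial>M) \<le> ennreal (e^2)"
      using key[OF e H] nn_integral_eq_integral[OF int] by simp
    then have "(\<integral>x. (z m x - w x)^2 \<partial>M) \<le> e^2"
      by (simp add: ennreal_le_iff)
    then show "L2norm M (\<lambda>x. z m x - w x) \<le> e"
      unfolding L2norm_def using e by (simp add: real_le_lsqrt)
  qed
  have lim: "\<exists>N. \<forall>m\<ge>N. L2 M (\<lambda>x. z m x - w x) \<and> L2norm M (\<lambda>x. z m x - w x) \<le> e" if "e > 0" for e
    using Cauchy[OF that] key2[OF that] by meson
  obtain m where "L2 M (\<lambda>x. z m x - w x)" using lim[of 1] by force
  from L2_diff[OF L2[of m] this] have "L2 M w" by simp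
  moreover have "(\<lambda>n. L2norm M (\<lambda>x. z n x - w x)) \<longlonglongrightarrow> 0"
  proof (rule LIMSEQ_I)
    fix e :: real assume "e > 0"
    then obtain N where "\<forall>m\<ge>N. L2norm M (\<lambda>x. z m x - w x) \<le> e/2"
      using lim[of "e/2"] by auto
    then show "\<exists>N. \<forall>n\<ge>N. norm (L2norm M (\<lambda>x. z n x - w x) - 0) < e"
      using \<open>e > 0\<close> by (intro exI[of _ N]) force
  qed
  ultimately show ?thesis by blast
qed

end

subsection \<open>Symmetric contraction semigroups with a spectral gap\<close>

text \<open>The values \<open>T t f\<close> matter only up to null sets, so the algebraic laws are
  stated against test functions.\<close>

locale symmetric_semigroup = prob_space M for M :: "'s measure" +
  fixes T :: "real \<Rightarrow> ('s \<Rightarrow> real) \<Rightarrow> ('s \<Rightarrow> real)"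
  assumes T_L2 [simp, intro]: "0 \<le> t \<Longrightarrow> L2 M f \<Longrightarrow> L2 M (T t f)"
    and T_sym: "0 \<le> t \<Longrightarrow> L2 M f \<Longrightarrow> L2 M g \<Longrightarrow> ip M (T t f) g = ip M f (T t g)"
    and T_semigroup: "0 \<le> s \<Longrightarrow> 0 \<le> t \<Longrightarrow> L2 M f \<Longrightarrow> L2 M g \<Longrightarrow> ip M (T s (T t f)) g = ip M (T (s + t) f) g"
    and T_contr: "0 \<le> t \<Longrightarrow> L2 M f \<Longrightarrow> L2norm M (T t f) \<le> L2norm M f"
    and T_one: "0 \<le> t \<Longrightarrow> L2 M f \<Longrightarrow> ip M (T t f) (\<lambda>_. 1) = ip M f (\<lambda>_. 1)"
    and T_cont: "L2 M f \<Longrightarrow> ((\<lambda>h. L2norm M (\<lambda>x. T h f x - f x)) \<longlongrightarrow> 0) (at_right 0)"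
begin

abbreviation "gen \<equiv> is_generator M T"

lemma T_split:
  assumes "0 \<le> s" "0 \<le> t" "L2 M f" "L2 M g"
  shows "ip M (T (s + t) f) g = ip M (T s f) (T t g)"
  using T_semigroup[of t s f g] T_sym[of t "T s f" g] assms by (simp add: add.commute)

text \<open>Symmetry moves the factor \<open>T (t - s)\<close> onto the test function, where it
  contracts.\<close>

lemma T_mono:
  assumes "0 \<le> s" "s \<le> t" "L2 M f"
  shows "L2norm M (T t f) \<le> L2norm M (T s f)"
proof (rule L2norm_le_dual)
  fix g assume g: "L2 M g"
  have "ip M (T t f) g = ip M (T s f) (T (t - s) g)"
    using T_split[of s "t - s" f g] assms g by simp
  also have "\<dots> \<le> L2norm M (T s f) * L2norm M (T (t - s) g)"
    using assms g by (intro ip_le_norms) auto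
  also have "\<dots> \<le> L2norm M (T s f) * L2norm M g"
    using assms g by (intro mult_left_mono T_contr) auto
  finally show "ip M (T t f) g \<le> L2norm M (T s f) * L2norm M g" .
qed (use assms in auto)

lemma T_log_convex:
  assumes "0 \<le> t" "L2 M f"
  shows "(L2norm M (T t f))^2 \<le> L2norm M (T (2 * t) f) * L2norm M f"
proof -
  have "(L2norm M (T t f))^2 = ip M (T (2 * t) f) f"
    using T_split[of t t f f] assms by (simp add: L2norm_sq)
  also have "\<dots> \<le> L2norm M (T (2 * t) f) * L2norm M f"
    using assms by (intro ip_le_norms) auto
  finally show ?thesis .
qed

text \<open>Log-convexity upgrades any exponential bound to constant one: iterating it gives
  \<open>(\<parallel>T t f\<parallel> / \<parallel>f\<parallel>)^(2^n) \<le> \<parallel>T (2^n t) f\<parallel> / \<parallel>f\<parallel>\<close>.\<close>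
lemma decay_sharp:
  assumes f: "L2 M f" and dec: "\<And>t. t \<ge> t0 \<Longrightarrow> L2norm M (T t f) \<le> C * exp (- \<delta> * t)"
    and t: "0 \<le> t"
  shows "L2norm M (T t f) \<le> exp (- \<delta> * t) * L2norm M f"
proof (cases "t = 0 \<or> L2norm M f = 0")
  case True
  then show ?thesis using T_contr[OF t f] by auto
next
  case False
  define N where "N = L2norm M f"
  have N: "N > 0" and t: "t > 0" using False t by (auto simp: N_def less_le)
  \<comment> \<open>The claim is \<open>a \<le> 1\<close>. For \<open>a > 1\<close> the powers
    \<open>a^(2^n)\<close> would be unbounded, but the iteration keeps them below
    \<open>C / N\<close>.\<close>
  define a where "a = L2norm M (T t f) * exp (\<delta> * t) / N"
  have iter: "(L2norm M (T t f) / N)^(2^n) \<le> L2norm M (T (2^n * t) f) / N" for n :: nat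
  proof (induction n)
    case (Suc n)
    have "(L2norm M (T t f) / N)^(2^Suc n) = ((L2norm M (T t f) / N)^(2^n))^2"
      by (simp add: power_mult[symmetric] mult.commute)
    also have "\<dots> \<le> (L2norm M (T (2^n * t) f) / N)^2"
      using N by (intro power_mono Suc.IH) auto
    also have "\<dots> \<le> L2norm M (T (2 * (2^n * t)) f) * N / N^2"
      unfolding power_divide N_def using T_log_convex[of "2^n * t" f] t f
      by (intro divide_right_mono) auto
    also have "\<dots> = L2norm M (T (2^Suc n * t) f) / N"
      using N by (simp add: power2_eq_square mult.assoc)
    finally show ?case .
  qed simp
  have bound: "a^(2^n) \<le> C / N" if "2^n * t \<ge> t0" for n :: nat
  proof -
    have "a^(2^n) = (L2norm M (T t f) / N)^(2^n) * exp (\<delta> * (2^n * t))"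
      unfolding a_def by (simp add: power_divide power_mult_distrib exp_of_nat_mult[symmetric] ac_simps)
    also have "\<dots> \<le> (L2norm M (T (2^n * t) f) / N) * exp (\<delta> * (2^n * t))"
      by (intro mult_right_mono iter) simp
    also have "\<dots> \<le> (C * exp (- \<delta> * (2^n * t)) / N) * exp (\<delta> * (2^n * t))"
      using N by (intro mult_right_mono divide_right_mono dec that) auto
    also have "\<dots> = C / N"
      by (simp add: exp_minus field_simps)
    finally show ?thesis .
  qed
  have "a \<le> 1"
  proof (rule ccontr)
    assume "\<not> a \<le> 1"
    then obtain K0 where K0: "C / N < a^K0" using real_arch_pow[of a "C / N"] by auto
    have K: "C / N < a^n" if "n \<ge> K0" for n
      using K0 power_increasing[OF that, of a] \<open>\<not> a \<le> 1\<close> by linarith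
    obtain m :: nat where m: "m \<ge> t0 / t" using real_arch_simple by blast
    \<comment> \<open>As \<open>n < 2^n\<close>, this \<open>n\<close> ensures both
      \<open>2^n * t \<ge> t0\<close> and \<open>2^n \<ge> K0\<close>.\<close>
    define n where "n = max m K0"
    have n: "n < 2^n" by simp
    have "real n < 2^n" using n by (metis of_nat_less_iff of_nat_numeral of_nat_power)
    moreover have "real m \<le> real n" by (simp add: n_def)
    ultimately have "t0 / t \<le> 2^n" using m by linarith
    then have "a^(2^n) \<le> C / N" using t by (intro bound) (simp add: field_simps)
    moreover have "K0 \<le> n" by (simp add: n_def)
    then have "a^(2^n) > C / N" using n by (intro K) linarith
    ultimately show False by simp
  qed
  then show ?thesis
    using N by (simp add: a_def N_def[symmetric] exp_minus field_simps)
qed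

section \<open>The generator: invariance, linearity, sign, symmetry, derivative\<close>

lemma gen_L2 [dest]: "gen x q \<Longrightarrow> L2 M x \<and> L2 M q"
  by (simp add: is_generator_def)

lemma gen_lim: "gen x q \<Longrightarrow> ((\<lambda>h. L2norm M (\<lambda>y. (T h x y - x y) / h - q y)) \<longlongrightarrow> 0) (at_right 0)"
  by (simp add: is_generator_def)

lemma eventually_pos: "\<forall>\<^sub>F h in at_right (0::real). 0 < h"
  by (rule eventually_at_right_less)

lemma gen_ip_lim:
  assumes "gen x q" "L2 M f"
  shows "((\<lambda>h. (ip M (T h x) f - ip M x f) / h) \<longlongrightarrow> ip M q f) (at_right 0)"
proof (rule LIM_zero_cancel, rule Lim_null_comparison)
  have L: "L2 M x" "L2 M q" using assms by auto
  show "\<forall>\<^sub>F h in at_right 0. norm ((ip M (T h x) f - ip M x f) / h - ip M q f)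
      \<le> L2norm M (\<lambda>y. (T h x y - x y) / h - q y) * L2norm M f"
    using eventually_pos
  proof eventually_elim
    case (elim h)
    have "(ip M (T h x) f - ip M x f) / h - ip M q f = ip M (\<lambda>y. (T h x y - x y) / h - q y) f"
      using L assms elim by (simp add: ip_simps)
    then show ?case
      using ip_Cauchy_Schwarz[of M "\<lambda>y. (T h x y - x y) / h - q y" f] L assms elim by simp
  qed
  show "((\<lambda>h. L2norm M (\<lambda>y. (T h x y - x y) / h - q y) * L2norm M f) \<longlongrightarrow> 0) (at_right 0)"
    using tendsto_mult_right[OF gen_lim[OF assms(1)], of "L2norm M f"] by simp
qed

text \<open>Under a test function \<open>T t\<close> commutes with difference quotients and passes
  to the test function, so the error for \<open>T t x\<close> is at most the error for
  \<open>x\<close>.\<close>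

lemma gen_T:
  assumes "gen x q" "0 \<le> t"
  shows "gen (T t x) (T t q)"
proof -
  have L: "L2 M x" "L2 M q" using assms by auto
  have "((\<lambda>h. L2norm M (\<lambda>y. (T h (T t x) y - T t x y) / h - T t q y)) \<longlongrightarrow> 0) (at_right 0)"
  proof (rule Lim_null_comparison[OF _ gen_lim[OF assms(1)]])
    show "\<forall>\<^sub>F h in at_right 0. norm (L2norm M (\<lambda>y. (T h (T t x) y - T t x y) / h - T t q y))
       \<le> L2norm M (\<lambda>y. (T h x y - x y) / h - q y)"
      using eventually_pos
    proof eventually_elim
      case (elim h)
      have "L2norm M (\<lambda>y. (T h (T t x) y - T t x y) / h - T t q y) \<le> L2norm M (\<lambda>y. (T h x y - x y) / h - q y)"
      proof (rule L2norm_le_dual)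
        fix k assume k: "L2 M k"
        have "ip M (\<lambda>y. (T h (T t x) y - T t x y) / h - T t q y) k = ip M (\<lambda>y. (T h x y - x y) / h - q y) (T t k)"
          using L assms k elim T_split[of h t x k] T_semigroup[of h t x k]
          by (simp add: ip_simps T_sym)
        also have "\<dots> \<le> L2norm M (\<lambda>y. (T h x y - x y) / h - q y) * L2norm M (T t k)"
          using L assms k elim by (intro ip_le_norms) auto
        also have "\<dots> \<le> L2norm M (\<lambda>y. (T h x y - x y) / h - q y) * L2norm M k"
          using assms k by (intro mult_left_mono T_contr) auto
        finally show "ip M (\<lambda>y. (T h (T t x) y - T t x y) / h - T t q y) k
          \<le> L2norm M (\<lambda>y. (T h x y - x y) / h - q y) * L2norm M k" .
      qed (use L assms elim in auto)
      then show ?case by simp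
    qed
  qed
  then show ?thesis using L assms by (simp add: is_generator_def)
qed

text \<open>Linearity of \<open>T h\<close> is available only weakly: by symmetry,
  \<open>ip M (T h u) k\<close> equals \<open>ip M u (T h k)\<close>, which is linear in
  \<open>u\<close>.\<close>

lemma gen_lincomb:
  assumes "gen x q" "gen y r"
  shows "gen (\<lambda>z. x z + c * y z) (\<lambda>z. q z + c * r z)"
proof -
  have L: "L2 M x" "L2 M q" "L2 M y" "L2 M r" using assms by auto
  let ?X = "\<lambda>h. L2norm M (\<lambda>z. (T h x z - x z) / h - q z)"
  let ?Y = "\<lambda>h. L2norm M (\<lambda>z. (T h y z - y z) / h - r z)"
  let ?u = "\<lambda>z. x z + c * y z"
  have "((\<lambda>h. L2norm M (\<lambda>z. (T h ?u z - ?u z) / h - (q z + c * r z))) \<longlongrightarrow> 0) (at_right 0)"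
  proof (rule Lim_null_comparison)
    show "((\<lambda>h. ?X h + \<bar>c\<bar> * ?Y h) \<longlongrightarrow> 0) (at_right 0)"
      using tendsto_add[OF gen_lim[OF assms(1)] tendsto_mult_left[OF gen_lim[OF assms(2)], of "\<bar>c\<bar>"]] by simp
    show "\<forall>\<^sub>F h in at_right 0. norm (L2norm M (\<lambda>z. (T h ?u z - ?u z) / h - (q z + c * r z)))
       \<le> ?X h + \<bar>c\<bar> * ?Y h"
      using eventually_pos
    proof eventually_elim
      case (elim h)
      have "L2norm M (\<lambda>z. (T h ?u z - ?u z) / h - (q z + c * r z)) \<le> ?X h + \<bar>c\<bar> * ?Y h"
      proof (rule L2norm_le_dual)
        fix k assume k: "L2 M k"
        have "ip M (\<lambda>z. (T h ?u z - ?u z) / h - (q z + c * r z)) k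
          = ip M (\<lambda>z. (T h x z - x z) / h - q z) k + c * ip M (\<lambda>z. (T h y z - y z) / h - r z) k"
          using L k elim by (simp add: ip_simps T_sym[of h x] T_sym[of h y] T_sym[of h ?u] field_simps)
        also have "\<dots> \<le> ?X h * L2norm M k + \<bar>c\<bar> * (?Y h * L2norm M k)"
        proof (rule add_mono)
          show "ip M (\<lambda>z. (T h x z - x z) / h - q z) k \<le> ?X h * L2norm M k"
            using L k elim by (intro ip_le_norms) auto
          have "c * ip M (\<lambda>z. (T h y z - y z) / h - r z) k \<le> \<bar>c\<bar> * \<bar>ip M (\<lambda>z. (T h y z - y z) / h - r z) k\<bar>"
            by (metis abs_ge_self abs_mult)
          also have "\<dots> \<le> \<bar>c\<bar> * (?Y h * L2norm M k)"
            using L k elim by (intro mult_left_mono ip_Cauchy_Schwarz) auto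
          finally show "c * ip M (\<lambda>z. (T h y z - y z) / h - r z) k \<le> \<bar>c\<bar> * (?Y h * L2norm M k)" .
        qed
        finally show "ip M (\<lambda>z. (T h ?u z - ?u z) / h - (q z + c * r z)) k \<le> (?X h + \<bar>c\<bar> * ?Y h) * L2norm M k"
          by (simp add: algebra_simps)
      qed (use L elim in auto)
      then show ?case by simp
    qed
  qed
  then show ?thesis using L by (simp add: is_generator_def)
qed

lemma gen_nonpos:
  assumes "gen x q"
  shows "ip M q x \<le> 0"
proof (rule tendsto_upperbound)
  have L: "L2 M x" using assms by auto
  show "((\<lambda>h. (ip M (T h x) x - ip M x x) / h) \<longlongrightarrow> ip M q x) (at_right 0)"
    by (rule gen_ip_lim[OF assms L])
  show "\<forall>\<^sub>F h in at_right 0. (ip M (T h x) x - ip M x x) / h \<le> 0"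
    using eventually_pos
  proof eventually_elim
    case (elim h)
    have "ip M (T h x) x \<le> L2norm M (T h x) * L2norm M x"
      using L elim by (intro ip_le_norms) auto
    also have "\<dots> \<le> L2norm M x * L2norm M x"
      using L elim by (intro mult_right_mono T_contr) auto
    also have "\<dots> = ip M x x" by (metis L2norm_sq power2_eq_square)
    finally show ?case using elim by (simp add: divide_le_0_iff)
  qed
qed simp

lemma gen_sym:
  assumes "gen x q" "gen y r"
  shows "ip M q y = ip M x r"
proof -
  have L: "L2 M x" "L2 M y" using assms by auto
  have "((\<lambda>h. (ip M (T h x) y - ip M x y) / h) \<longlongrightarrow> ip M r x) (at_right 0)"
  proof (rule Lim_transform_eventually[OF gen_ip_lim[OF assms(2) L(1)]])
    show "\<forall>\<^sub>F h in at_right 0. (ip M (T h y) x - ip M y x) / h = (ip M (T h x) y - ip M x y) / h"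
      using eventually_pos
      by eventually_elim (use L in \<open>simp add: T_sym ip_commute[of M y]\<close>)
  qed
  from tendsto_unique[OF _ gen_ip_lim[OF assms(1) L(2)] this] show ?thesis
    by (simp add: ip_commute[of M r])
qed

lemma gen_one:
  assumes "gen x q"
  shows "ip M q (\<lambda>_. 1) = 0"
proof -
  have L: "L2 M x" using assms by auto
  have "((\<lambda>h. (ip M (T h x) (\<lambda>_. 1) - ip M x (\<lambda>_. 1)) / h) \<longlongrightarrow> 0) (at_right 0)"
    by (rule Lim_transform_eventually[OF tendsto_const])
      (use eventually_pos in eventually_elim, use L in \<open>simp add: T_one\<close>)
  from tendsto_unique[OF _ gen_ip_lim[OF assms L2_const] this] show ?thesis by simp
qed

text \<open>The right derivative is the generator limit tested against \<open>T s f\<close>. The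
  left one also needs strong continuity, because there the quotient compares with
  \<open>T h q\<close> instead of \<open>q\<close>.\<close>

lemma gen_deriv:
  assumes g: "gen x q" and f: "L2 M f" and s: "0 < s"
  shows "((\<lambda>s. ip M (T s x) f) has_real_derivative ip M (T s q) f) (at s)"
proof -
  have L: "L2 M x" "L2 M q" using g by auto
  let ?D = "\<lambda>h. (ip M (T (s + h) x) f - ip M (T s x) f) / h"
  have "(?D \<longlongrightarrow> ip M (T s q) f) (at_right 0)"
  proof -
    have "((\<lambda>h. (ip M (T h x) (T s f) - ip M x (T s f)) / h) \<longlongrightarrow> ip M (T s q) f) (at_right 0)"
      using gen_ip_lim[OF g, of "T s f"] L f s by (simp add: T_sym)
    then show ?thesis
    proof (rule Lim_transform_eventually)
      show "\<forall>\<^sub>F h in at_right 0. (ip M (T h x) (T s f) - ip M x (T s f)) / h = ?D h"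
        using eventually_pos
      proof eventually_elim
        case (elim h)
        have "ip M (T (s + h) x) f = ip M (T h x) (T s f)"
          using T_split[of h s x f] L f s elim by (simp add: add.commute)
        then show ?case using L f s by (simp add: T_sym)
      qed
    qed
  qed
  moreover have "(?D \<longlongrightarrow> ip M (T s q) f) (at_left 0)"
  proof -
    let ?B = "\<lambda>h. (L2norm M (\<lambda>y. (T h x y - x y) / h - q y) + L2norm M (\<lambda>y. T h q y - q y)) * L2norm M f"
    have "((\<lambda>h. ?D (-h)) \<longlongrightarrow> ip M (T s q) f) (at_right 0)"
    proof (rule LIM_zero_cancel, rule Lim_null_comparison)
      show "(?B \<longlongrightarrow> 0) (at_right 0)"
        using tendsto_mult_right[OF tendsto_add[OF gen_lim[OF g] T_cont[OF L(2)]], of "L2norm M f"] by simp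
      have "\<forall>\<^sub>F h in at_right 0. h < s"
        using s by (rule order_tendstoD(2)[OF tendsto_ident_at])
      with eventually_pos
      show "\<forall>\<^sub>F h in at_right 0. norm (?D (-h) - ip M (T s q) f) \<le> ?B h"
      proof eventually_elim
        case (elim h)
        \<comment> \<open>Moving \<open>T (s - h)\<close> onto \<open>f\<close> leaves the quotient
          at time 0: \<open>?u\<close> is its error and \<open>?v\<close> the cost of replacing
          \<open>q\<close> by \<open>T h q\<close>.\<close>
        let ?f = "T (s - h) f"
        have e1: "ip M (T s x) f = ip M (T h x) ?f" "ip M (T s q) f = ip M (T h q) ?f"
          using T_split[of h "s - h" x f] T_split[of h "s - h" q f] L f elim by simp_all
        have e2: "ip M (T (s - h) x) f = ip M x ?f"
          using L f elim by (simp add: T_sym)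
        let ?u = "\<lambda>y. (T h x y - x y) / h - q y" and ?v = "\<lambda>y. T h q y - q y"
        have uv: "L2 M ?u" "L2 M ?v" "L2 M ?f" using L f elim by auto
        have eq: "?D (-h) - ip M (T s q) f = ip M ?u ?f - ip M ?v ?f"
          using L f elim e1 e2 by (simp add: ip_simps field_simps)
        have "\<bar>ip M ?u ?f - ip M ?v ?f\<bar> \<le> \<bar>ip M ?u ?f\<bar> + \<bar>ip M ?v ?f\<bar>"
          by (rule abs_triangle_ineq4)
        also have "\<dots> \<le> L2norm M ?u * L2norm M ?f + L2norm M ?v * L2norm M ?f"
          using uv by (intro add_mono ip_Cauchy_Schwarz) auto
        also have "\<dots> = (L2norm M ?u + L2norm M ?v) * L2norm M ?f"
          by (simp only: distrib_right)
        also have "\<dots> \<le> (L2norm M ?u + L2norm M ?v) * L2norm M f"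
          using f elim by (intro mult_left_mono T_contr) auto
        finally show ?case unfolding eq real_norm_def .
      qed
    qed
    then show ?thesis by (simp add: filterlim_at_left_to_right)
  qed
  ultimately show ?thesis
    unfolding DERIV_def by (intro filterlim_split_at)
qed

section \<open>From the resolvent set to a quadratic form inequality\<close>

lemma resolvent_solve:
  assumes "in_resolvent M T lam" "L2 M y"
  obtains x q where "gen x q" "\<And>k. L2 M k \<Longrightarrow> lam * ip M x k - ip M q k = ip M y k"
proof -
  obtain x q where g: "gen x q" and AE: "AE z in M. lam * x z - q z = y z"
    using assms unfolding in_resolvent_def by blast
  have L: "L2 M x" "L2 M q" using g by auto
  have "lam * ip M x k - ip M q k = ip M y k" if "L2 M k" for k
    using ip_cong_AE[OF AE _ assms(2) that] L that by (simp add: ip_simps)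
  then show thesis using g that by blast
qed

text \<open>The constant in \<open>in_resolvent\<close> may have any sign; squaring the bound and
  adding 1 gives a positive constant for squared norms.\<close>

lemma resolvent_bound:
  assumes "in_resolvent M T lam"
  obtains C where "0 < C"
    "\<And>x q. gen x q \<Longrightarrow> ip M x x \<le> C * ip M (\<lambda>z. lam * x z - q z) (\<lambda>z. lam * x z - q z)"
proof -
  obtain C where C: "\<And>x q. gen x q \<Longrightarrow> L2norm M x \<le> C * L2norm M (\<lambda>z. lam * x z - q z)"
    using assms unfolding in_resolvent_def by blast
  have "ip M x x \<le> (C^2 + 1) * ip M (\<lambda>z. lam * x z - q z) (\<lambda>z. lam * x z - q z)" if "gen x q" for x q
  proof -
    let ?f = "\<lambda>z. lam * x z - q z"
    have "ip M x x \<le> (C * L2norm M ?f)^2"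
      using power_mono[OF C[OF that] L2norm_nonneg, of 2] by (simp add: L2norm_sq)
    also have "\<dots> = C^2 * ip M ?f ?f" by (simp add: power_mult_distrib L2norm_sq)
    also have "\<dots> \<le> (C^2 + 1) * ip M ?f ?f"
      by (intro mult_right_mono ip_self_nonneg) simp
    finally show ?thesis .
  qed
  moreover have "0 < C^2 + 1" by (simp add: add_nonneg_pos)
  ultimately show thesis using that by blast
qed

text \<open>The form \<open>\<langle>q, x\<rangle>\<close> is minus the Dirichlet form. If the inequality failed, the bounded symmetric
  resolvent at \<open>-\<epsilon>\<close> would have a numerical range with infimum \<open>b < -1/\<epsilon>\<close>; the infimum is an
  approximate eigenvalue, which makes \<open>-\<epsilon> - 1/b\<close>, a point of \<open>(-\<epsilon>, 0)\<close>, an approximate eigenvalue of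
  the generator.\<close>
lemma gap_eps:
  assumes eps: "0 < \<epsilon>" and res: "\<And>lam. - \<epsilon> \<le> lam \<Longrightarrow> lam < 0 \<Longrightarrow> in_resolvent M T lam"
    and x0: "gen x0 q0"
  shows "0 \<le> \<epsilon> * ip M q0 x0 + ip M q0 q0"
proof (rule ccontr)
  assume neg: "\<not> 0 \<le> \<epsilon> * ip M q0 x0 + ip M q0 q0"
  have r: "in_resolvent M T (- \<epsilon>)" using res[of "-\<epsilon>"] eps by simp
  \<comment> \<open>Let \<open>R\<close> be the resolvent at \<open>- \<epsilon>\<close>. Then
    \<open>x = R f\<close> for \<open>f = F x q\<close>, \<open>num\<close> is the form of
    \<open>R\<close> at \<open>f\<close>, and \<open>den\<close> is the squared norm of
    \<open>f\<close>. Indexing by generator pairs avoids choosing \<open>R\<close> as a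
    function.\<close>
  define F where "F x q = (\<lambda>z. (- \<epsilon>) * x z - q z)" for x q :: "'s \<Rightarrow> real"
  have F_L2: "L2 M (F x q)" if "gen x q" for x q
    unfolding F_def using that by (intro L2_diff L2_scale) auto
  define num where "num x q = ip M x (F x q)" for x q
  define den where "den x q = ip M (F x q) (F x q)" for x q
  have den_nonneg: "0 \<le> den x q" for x q unfolding den_def by (rule ip_self_nonneg)
  obtain C where C: "0 < C" "\<And>x q. gen x q \<Longrightarrow> ip M x x \<le> C * den x q"
    using resolvent_bound[OF r] unfolding den_def F_def by blast
  have num_bound: "\<bar>num x q\<bar> \<le> sqrt C * den x q" if "gen x q" for x q
  proof -
    have "(num x q)^2 \<le> ip M x x * den x q"
      unfolding num_def den_def using that by (intro ip_Cauchy_Schwarz_sq F_L2) auto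
    also have "\<dots> \<le> C * den x q * den x q"
      using C(2)[OF that] den_nonneg by (intro mult_right_mono)
    also have "\<dots> = (sqrt C * den x q)^2" using C(1) by (simp add: power_mult_distrib power2_eq_square)
    finally have "\<bar>num x q\<bar> \<le> \<bar>sqrt C * den x q\<bar>" by (simp add: abs_le_square_iff)
    then show ?thesis using C(1) den_nonneg[of x q] by (simp add: abs_mult)
  qed
  \<comment> \<open>Expanding gives \<open>\<epsilon> * num + den = \<epsilon> * ip M q0 x0 + ip M
    q0 q0\<close>, so the failure of the claim says that the Rayleigh quotient of \<open>R\<close>
    at this point is below \<open>- 1 / \<epsilon>\<close>.\<close>
  have num0: "num x0 q0 < - den x0 q0 / \<epsilon>"
  proof -
    have L: "L2 M x0" "L2 M q0" using x0 by auto
    have "\<epsilon> * num x0 q0 + den x0 q0 = \<epsilon> * ip M q0 x0 + ip M q0 q0"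
      using L unfolding num_def den_def F_def
      by (simp add: ip_simps ip_commute[of M x0 q0] algebra_simps)
    then show ?thesis using neg eps by (simp add: field_simps)
  qed
  have den0: "den x0 q0 > 0"
    using num0 num_bound[OF x0] den_nonneg[of x0 q0] by (cases "den x0 q0 = 0") auto
  define S where "S = {num x q / den x q | x q. gen x q \<and> den x q > 0}"
  have S_ne: "S \<noteq> {}" using x0 den0 unfolding S_def by blast
  have bdd: "bdd_below S"
  proof (rule bdd_belowI[of _ "- sqrt C"])
    fix s assume "s \<in> S"
    then obtain x q where "s = num x q / den x q" "gen x q" "den x q > 0" unfolding S_def by blast
    then show "- sqrt C \<le> s" using num_bound[of x q] by (simp add: pos_le_divide_eq abs_le_iff)
  qed
  define b where "b = Inf S"
  have pos: "b * den x q \<le> num x q" if "gen x q" for x q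
  proof (cases "den x q = 0")
    case True
    then show ?thesis using num_bound[OF that] by simp
  next
    case False
    then have d: "den x q > 0" using den_nonneg[of x q] by simp
    then have "b \<le> num x q / den x q"
      unfolding b_def using that by (intro cInf_lower bdd) (auto simp: S_def)
    then show ?thesis using d by (simp add: field_simps)
  qed
  have "b < - 1 / \<epsilon>"
  proof -
    have "b \<le> num x0 q0 / den x0 q0" using pos[OF x0] den0 by (simp add: field_simps)
    also have "\<dots> < - 1 / \<epsilon>" using num0 den0 by (simp add: field_simps)
    finally show ?thesis .
  qed
  then have b: "b < 0" "- 1 / b < \<epsilon>" "0 < - 1 / b"
  proof -
    assume *: "b < - 1 / \<epsilon>"
    have "- 1 / \<epsilon> < 0" using eps by simp
    with * show b0: "b < 0" by linarith
    then show "0 < - 1 / b" by (simp add: divide_less_0_iff)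
    show "- 1 / b < \<epsilon>" using * b0 eps by (simp add: field_simps)
  qed
  \<comment> \<open>\<open>R f = b f\<close> would mean
    \<open>x = b * (- \<epsilon> * x - q)\<close>, that is \<open>q = lam * x\<close>.\<close>
  define lam where "lam = - \<epsilon> - 1 / b"
  have "in_resolvent M T lam" unfolding lam_def using b by (intro res) auto
  then obtain C' where C': "0 < C'"
    "\<And>x q. gen x q \<Longrightarrow> ip M x x \<le> C' * ip M (\<lambda>z. lam * x z - q z) (\<lambda>z. lam * x z - q z)"
    using resolvent_bound by blast
  define K where "K = sqrt C + \<bar>b\<bar>"
  have K: "K \<ge> 0" unfolding K_def using C(1) by simp
  \<comment> \<open>Collects the constants of the estimate \<open>main\<close> below; the final 1
    makes \<open>D\<close> positive.\<close>
  define D where "D = 2 * (C' / b^2 + 1) / b^2 * K + 1"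
  have D: "D > 0" unfolding D_def using K C'(1) by (intro add_nonneg_pos mult_nonneg_nonneg) auto
  \<comment> \<open>A uniform lower bound for the form of \<open>R - b\<close> contradicts that
    \<open>b\<close> is the infimum. With \<open>y = (R - b) f\<close>, Cauchy-Schwarz for this
    nonnegative form bounds the squared norm of \<open>y\<close> by a multiple of its value
    \<open>\<alpha>\<close> at \<open>f\<close>, and the resolvent at \<open>lam\<close> bounds
    \<open>f\<close> by \<open>y\<close>.\<close>
  have main: "den x q \<le> D * (num x q - b * den x q)" if g1: "gen x q" for x q
  proof -
    define f where "f = F x q"
    have L: "L2 M x" "L2 M q" "L2 M f" using g1 F_L2[OF g1] by (auto simp: f_def)
    define y where "y = (\<lambda>z. x z - b * f z)"
    have Ly: "L2 M y" unfolding y_def using L by auto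
    define \<alpha> where "\<alpha> = num x q - b * den x q"
    have \<alpha>: "\<alpha> \<ge> 0" unfolding \<alpha>_def using pos[OF g1] by simp
    \<comment> \<open>\<open>x2\<close> is \<open>R y\<close>, and \<open>f2\<close> is
      \<open>y\<close> again, weakly, but now as the image of a generator pair, so that
      \<open>pos\<close> applies to \<open>f + t * f2\<close>.\<close>
    obtain x2 q2 where g2: "gen x2 q2" and s2: "\<And>k. L2 M k \<Longrightarrow> (- \<epsilon>) * ip M x2 k - ip M q2 k = ip M y k"
      using resolvent_solve[OF r Ly] by blast
    define f2 where "f2 = F x2 q2"
    have L2: "L2 M x2" "L2 M q2" "L2 M f2" using g2 F_L2[OF g2] by (auto simp: f2_def)
    have f2: "ip M f2 k = ip M y k" if "L2 M k" for k
      using s2[OF that] L2 that unfolding f2_def F_def by (simp add: ip_simps)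
    have sym: "ip M x2 f = ip M x f2"
      using gen_sym[OF g1 g2] L L2 unfolding f_def f2_def F_def
      by (simp add: ip_simps ip_commute[of M x2])
    have f2f2: "ip M f2 f2 = ip M y y"
      using f2[of f2] f2[of y] L2 Ly ip_commute[of M y f2] by simp
    define \<gamma> where "\<gamma> = num x2 q2 - b * den x2 q2"
    \<comment> \<open>The form of \<open>R - b\<close> has diagonal values \<open>\<alpha>\<close>
      at \<open>f\<close> and \<open>\<gamma>\<close> at \<open>y\<close>; its mixed value is
      \<open>ip M y y\<close>.\<close>
    have "(ip M y y)^2 \<le> \<alpha> * \<gamma>"
    proof (rule discriminant_bound)
      fix t
      have F: "F (\<lambda>z. x z + t * x2 z) (\<lambda>z. q z + t * q2 z) = (\<lambda>z. f z + t * f2 z)"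
        unfolding F_def f_def f2_def by (auto simp: algebra_simps)
      have xf2: "ip M x f2 = ip M y y + b * ip M f f2"
      proof -
        have "ip M y y = ip M y f2" using f2[of y] Ly by (simp add: ip_commute)
        also have "\<dots> = ip M x f2 - b * ip M f f2" unfolding y_def using L L2 by (simp add: ip_simps)
        finally show ?thesis by simp
      qed
      have "0 \<le> num (\<lambda>z. x z + t * x2 z) (\<lambda>z. q z + t * q2 z) - b * den (\<lambda>z. x z + t * x2 z) (\<lambda>z. q z + t * q2 z)"
        using pos[OF gen_lincomb[OF g1 g2, of t]] by simp
      also have "\<dots> = \<alpha> + 2 * t * ip M y y + t^2 * \<gamma>"
        unfolding num_def den_def F \<alpha>_def \<gamma>_def f_def[symmetric] f2_def[symmetric] using L L2 sym xf2
        by (simp add: ip_simps ip_commute[of M f2 f] algebra_simps power2_eq_square)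
      finally show "0 \<le> \<alpha> + 2 * t * ip M y y + t^2 * \<gamma>" .
    next
      show "0 \<le> \<gamma>" unfolding \<gamma>_def using pos[OF g2] by simp
    qed
    also have "\<dots> \<le> \<alpha> * (K * ip M y y)"
    proof (rule mult_left_mono[OF _ \<alpha>])
      have "den x2 q2 = ip M y y" unfolding den_def f2_def[symmetric] by (rule f2f2)
      then show "\<gamma> \<le> K * ip M y y"
        using num_bound[OF g2] b(1) unfolding \<gamma>_def K_def by (auto simp: algebra_simps)
    qed
    finally have yy: "ip M y y \<le> K * \<alpha>"
      using ip_self_nonneg[of M y] K \<alpha> by (cases "ip M y y = 0") (auto simp: power2_eq_square less_le mult.commute)
    \<comment> \<open>This is what \<open>lam\<close> was chosen for: \<open>lam - Q\<close> maps
      \<open>x\<close> to a multiple of \<open>y\<close>, so a bounded resolvent controls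
      \<open>x\<close> by \<open>y\<close>. Then \<open>b * f = x - y\<close> controls
      \<open>f\<close>.\<close>
    have "(\<lambda>z. lam * x z - q z) = (\<lambda>z. (- 1 / b) * y z)"
      unfolding lam_def y_def f_def F_def using b(1) by (auto simp: field_simps)
    then have xx: "ip M x x \<le> C' / b^2 * ip M y y"
      using C'(2)[OF g1] by (simp add: ip_simps power2_eq_square)
    have "b^2 * den x q = ip M (\<lambda>z. x z - y z) (\<lambda>z. x z - y z)"
      unfolding den_def f_def[symmetric] y_def by (simp add: ip_simps power2_eq_square)
    also have "\<dots> \<le> 2 * (ip M x x + ip M y y)"
    proof -
      have "0 \<le> ip M (\<lambda>z. x z + y z) (\<lambda>z. x z + y z)" by (rule ip_self_nonneg)
      then show ?thesis using L Ly by (simp add: ip_simps ip_commute[of M y x])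
    qed
    also have "\<dots> \<le> 2 * (C' / b^2 + 1) * ip M y y"
    proof -
      have "2 * (ip M x x + ip M y y) \<le> 2 * (C' / b^2 * ip M y y + ip M y y)" using xx by simp
      then show ?thesis by (simp add: algebra_simps)
    qed
    also have "\<dots> \<le> 2 * (C' / b^2 + 1) * (K * \<alpha>)"
      using yy C'(1) by (intro mult_left_mono) auto
    finally have "den x q \<le> 2 * (C' / b^2 + 1) * (K * \<alpha>) / b^2"
      using b(1) by (simp add: pos_le_divide_eq mult.commute)
    also have "\<dots> \<le> D * \<alpha>"
      using \<alpha> unfolding D_def by (simp add: algebra_simps)
    finally show ?thesis unfolding \<alpha>_def .
  qed
  have "b + 1 / D \<le> Inf S"
  proof (rule cInf_greatest[OF S_ne])
    fix s assume "s \<in> S"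
    then obtain x q where "s = num x q / den x q" "gen x q" "den x q > 0" unfolding S_def by blast
    moreover from this have "1 / D \<le> (num x q - b * den x q) / den x q"
      using main[of x q] D by (simp add: pos_le_divide_eq pos_divide_le_eq mult.commute)
    ultimately show "b + 1 / D \<le> s" by (simp add: diff_divide_distrib)
  qed
  then show False using D unfolding b_def by simp
qed

text \<open>\<open>gap_eps\<close> asks for the resolvent at its left endpoint, while the gap grants
  only an open interval. A strict failure at \<open>\<delta>\<close> persists at some smaller
  parameter, where \<open>gap_eps\<close> applies.\<close>

lemma spectral_gap_form:
  assumes "\<delta> > 0" and spec: "spectral_gap M T \<delta>" and "gen x q"
  shows "0 \<le> \<delta> * ip M q x + ip M q q"
proof (rule ccontr)
  assume neg: "\<not> 0 \<le> \<delta> * ip M q x + ip M q q"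
  have "0 \<le> ip M q q" by (rule ip_self_nonneg)
  then have qx: "ip M q x < 0"
    using neg assms(1) by (metis add_nonneg_nonneg less_eq_real_def linorder_not_le mult_nonneg_nonneg)
  \<comment> \<open>As \<open>ip M q x < 0\<close>, the form with parameter
    \<open>\<epsilon>\<close> is nonnegative exactly for \<open>\<epsilon> \<le> r\<close>; the
    midpoint of \<open>r\<close> and \<open>\<delta>\<close> is therefore already a failure.\<close>
  define r where "r = ip M q q / (- ip M q x)"
  have r: "0 \<le> r" "r < \<delta>" using qx neg \<open>0 \<le> ip M q q\<close> unfolding r_def by (auto simp: field_simps)
  define \<epsilon> where "\<epsilon> = (r + \<delta>) / 2"
  have e: "0 < \<epsilon>" "\<epsilon> < \<delta>" "r < \<epsilon>" using r unfolding \<epsilon>_def by auto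
  have "0 \<le> \<epsilon> * ip M q x + ip M q q"
    using spec e by (intro gap_eps[OF e(1) _ assms(3)]) (auto simp: spectral_gap_def)
  moreover have "ip M q q < \<epsilon> * (- ip M q x)"
    using e(3) qx unfolding r_def by (subst (asm) pos_divide_less_eq) auto
  ultimately show False by simp
qed

text \<open>The limit of \<open>T n f\<close> is invariant under the semigroup, hence in the kernel of the generator. This
  rules out that \<open>0\<close> is an approximate eigenvalue on mean-zero functions, which the resolvent
  condition alone does not exclude.\<close>
lemma ergodic:
  assumes f: "L2 M f" and f1: "ip M f (\<lambda>_. 1) = 0"
    and ker: "\<And>x q. gen x q \<Longrightarrow> AE z in M. q z = 0 \<Longrightarrow> \<exists>c. AE z in M. x z = c"
  shows "(\<lambda>n. L2norm M (T (real n) f)) \<longlonglongrightarrow> 0"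
proof -
  \<comment> \<open>\<open>ip M (T s f) (T t f)\<close> depends only on \<open>s + t\<close>; as
    \<open>\<psi>\<close> is decreasing and bounded below, expanding the squared norm of
    \<open>T s f - T t f\<close> yields the Cauchy property.\<close>
  define \<psi> where "\<psi> t = (L2norm M (T (t / 2) f))^2" for t
  have \<psi>: "ip M (T s f) (T t f) = \<psi> (s + t)" if "0 \<le> s" "0 \<le> t" for s t
    using that f T_split[of s t f f] T_split[of "(s+t)/2" "(s+t)/2" f f] T_sym[of t f "T s f"]
      T_semigroup[of t s f f] T_sym[of t "T s f" f]
    by (simp add: \<psi>_def L2norm_sq add.commute)
  have mono: "\<psi> t \<le> \<psi> s" if "0 \<le> s" "s \<le> t" for s t
    unfolding \<psi>_def using that f by (intro power_mono T_mono) auto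
  define L where "L = Inf (\<psi> ` {0..})"
  have bdd: "bdd_below (\<psi> ` {0..})" by (rule bdd_belowI[of _ 0]) (auto simp: \<psi>_def)
  have L: "L \<le> \<psi> t" if "0 \<le> t" for t unfolding L_def using that by (intro cInf_lower bdd) auto
  \<comment> \<open>Times are real, because invariance of the limit compares time
    \<open>real n\<close> with \<open>h + real n\<close>.\<close>
  have Cauchy: "\<exists>N::nat. \<forall>s\<ge>N. \<forall>t\<ge>N. L2norm M (\<lambda>z. T s f z - T t f z) \<le> e" if e: "e > 0" for e
  proof -
    \<comment> \<open>The two square terms are each below \<open>L + e^2 / 2\<close> and the mixed
      term is at least \<open>L\<close>, so the total is at most \<open>e^2\<close>.\<close>
    have "L < L + e^2 / 2" using e by simp
    then obtain t0 where t0: "t0 \<ge> 0" "\<psi> t0 < L + e^2 / 2"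
      unfolding L_def by (subst (asm) cInf_less_iff) (use bdd in auto)
    obtain N :: nat where N: "real N \<ge> t0" using real_arch_simple by blast
    have "L2norm M (\<lambda>z. T s f z - T t f z) \<le> e" if "s \<ge> real N" "t \<ge> real N" for s t :: real
    proof -
      have st: "0 \<le> s" "0 \<le> t" "t0 \<le> s" "t0 \<le> t" using that N by linarith+
      have "ip M (\<lambda>z. T s f z - T t f z) (\<lambda>z. T s f z - T t f z) = \<psi> (s + s) - 2 * \<psi> (s + t) + \<psi> (t + t)"
        using st f by (simp add: ip_simps \<psi> add.commute)
      also have "\<dots> \<le> e^2"
        using L[of "s + t"] mono[of t0 "s + s"] mono[of t0 "t + t"] st t0 by linarith
      finally have "(L2norm M (\<lambda>z. T s f z - T t f z))^2 \<le> e^2" by (simp add: L2norm_sq)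
      then show ?thesis using e by (simp add: power2_le_iff_abs_le)
    qed
    then show ?thesis by blast
  qed
  have "\<exists>w. L2 M w \<and> (\<lambda>n. L2norm M (\<lambda>z. T (real n) f z - w z)) \<longlonglongrightarrow> 0"
  proof (rule L2_complete)
    fix e :: real assume "e > 0"
    then obtain N :: nat where "\<forall>s\<ge>real N. \<forall>t\<ge>real N. L2norm M (\<lambda>z. T s f z - T t f z) \<le> e" using Cauchy[OF \<open>e > 0\<close>] by blast
    then show "\<exists>N. \<forall>m\<ge>N. \<forall>n\<ge>N. L2norm M (\<lambda>x. T (real m) f x - T (real n) f x) \<le> e"
      by (intro exI[of _ N]) simp
  qed (use f in simp)
  then obtain w where w: "L2 M w" and lim: "(\<lambda>n. L2norm M (\<lambda>z. T (real n) f z - w z)) \<longlonglongrightarrow> 0" by blast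
  have inv: "L2norm M (\<lambda>z. T h w z - w z) = 0" if h: "0 \<le> h" for h
  proof -
    have "L2norm M (\<lambda>z. T h w z - w z) \<le> e" if e: "e > 0" for e
    proof -
      obtain N :: nat where N: "\<forall>s\<ge>real N. \<forall>t\<ge>real N. L2norm M (\<lambda>z. T s f z - T t f z) \<le> e / 3"
        using Cauchy[of "e / 3"] e by auto
      have "\<forall>\<^sub>F n in sequentially. L2norm M (\<lambda>z. T (real n) f z - w z) < e / 3"
        using order_tendstoD(2)[OF lim, of "e / 3"] e by simp
      then obtain N2 where N2: "\<And>n. n \<ge> N2 \<Longrightarrow> L2norm M (\<lambda>z. T (real n) f z - w z) < e / 3"
        unfolding eventually_sequentially by blast
      define n where "n = max N N2"
      have n: "n \<ge> N" "L2norm M (\<lambda>z. T (real n) f z - w z) < e / 3"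
        using N2[of n] by (simp_all add: n_def)
      define u where "u = T (real n) f"
      have u: "L2 M u" unfolding u_def using f by simp
      show ?thesis
      proof (rule L2norm_le_dual)
        fix k assume k: "L2 M k"
        have n1: "L2norm M (\<lambda>z. u z - w z) \<le> e / 3" using n by (simp add: u_def)
        have a1: "\<bar>ip M (\<lambda>z. u z - w z) (T h k)\<bar> \<le> e / 3 * L2norm M k"
        proof -
          have "\<bar>ip M (\<lambda>z. u z - w z) (T h k)\<bar> \<le> L2norm M (\<lambda>z. u z - w z) * L2norm M (T h k)"
            using u w k h by (intro ip_Cauchy_Schwarz) auto
          also have "\<dots> \<le> e / 3 * L2norm M k"
            using n1 e k h by (intro mult_mono T_contr) auto
          finally show ?thesis .
        qed
        have a2: "\<bar>ip M (\<lambda>z. u z - w z) k\<bar> \<le> e / 3 * L2norm M k"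
        proof -
          have "\<bar>ip M (\<lambda>z. u z - w z) k\<bar> \<le> L2norm M (\<lambda>z. u z - w z) * L2norm M k"
            using u w k by (intro ip_Cauchy_Schwarz) auto
          also have "\<dots> \<le> e / 3 * L2norm M k"
            using n1 by (intro mult_right_mono) auto
          finally show ?thesis .
        qed
        have a3: "\<bar>ip M (\<lambda>z. T (h + real n) f z - u z) k\<bar> \<le> e / 3 * L2norm M k"
        proof -
          have "\<bar>ip M (\<lambda>z. T (h + real n) f z - u z) k\<bar> \<le> L2norm M (\<lambda>z. T (h + real n) f z - u z) * L2norm M k"
            using u f k h by (intro ip_Cauchy_Schwarz) auto
          also have "\<dots> \<le> e / 3 * L2norm M k"
            unfolding u_def using N n h by (intro mult_right_mono) auto
          finally show ?thesis .
        qed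
        have "ip M (T (h + real n) f) k = ip M u (T h k)"
          using T_split[of "real n" h f k] f k h unfolding u_def by (simp add: add.commute)
        \<comment> \<open>Three errors of size \<open>e / 3\<close>: replacing \<open>w\<close> by
          \<open>u\<close> before and after applying \<open>T h\<close>, and the Cauchy bound in
          between.\<close>
        then have "ip M (\<lambda>z. T h w z - w z) k
           = - ip M (\<lambda>z. u z - w z) (T h k) + ip M (\<lambda>z. T (h + real n) f z - u z) k + ip M (\<lambda>z. u z - w z) k"
          using w u f k h by (simp add: ip_simps T_sym)
        then show "ip M (\<lambda>z. T h w z - w z) k \<le> e * L2norm M k"
          using a1 a2 a3 by (simp add: abs_le_iff)
      qed (use w h e in auto)
    qed
    then show ?thesis by (meson L2norm_nonneg field_le_epsilon add_0 order_antisym le_add_same_cancel2 dense_ge)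
  qed
  have "((\<lambda>h. L2norm M (\<lambda>z. (T h w z - w z) / h - 0)) \<longlongrightarrow> 0) (at_right 0)"
  proof (rule Lim_transform_eventually[OF tendsto_const])
    show "\<forall>\<^sub>F h in at_right 0. 0 = L2norm M (\<lambda>z. (T h w z - w z) / h - 0)"
      using eventually_pos by eventually_elim (simp add: L2norm_divide inv)
  qed
  then have "gen w (\<lambda>_. 0)" unfolding is_generator_def using w by simp
  from ker[OF this] obtain c where c: "AE z in M. w z = c" by auto
  \<comment> \<open>Each \<open>T (real n) f\<close> has mean 0, so the limit does too; the constant
    \<open>c\<close> is this mean.\<close>
  have "ip M w (\<lambda>_. 1) = 0"
  proof -
    have "(\<lambda>n. - ip M w (\<lambda>_. 1)) \<longlonglongrightarrow> 0"
    proof (rule Lim_null_comparison[OF _ lim])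
      show "\<forall>\<^sub>F n in sequentially. norm (- ip M w (\<lambda>_. 1)) \<le> L2norm M (\<lambda>z. T (real n) f z - w z)"
      proof (rule always_eventually, rule allI)
        fix n
        have "- ip M w (\<lambda>_. 1) = ip M (\<lambda>z. T (real n) f z - w z) (\<lambda>_. 1)"
          using w f f1 by (simp add: ip_simps T_one)
        also have "\<bar>\<dots>\<bar> \<le> L2norm M (\<lambda>z. T (real n) f z - w z) * L2norm M (\<lambda>_. 1)"
          using w f by (intro ip_Cauchy_Schwarz) auto
        finally show "norm (- ip M w (\<lambda>_. 1)) \<le> L2norm M (\<lambda>z. T (real n) f z - w z)"
          by (simp add: L2norm_ip[of M "\<lambda>_. 1"])
      qed
    qed
    then show ?thesis by (simp add: tendsto_const_iff)
  qed
  moreover have "ip M w (\<lambda>_. 1) = c"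
    using ip_cong_AE[OF c w, of "\<lambda>_. 1"] by (simp add: ip_def prob_space)
  ultimately have "AE z in M. w z = 0" using c by simp
  then have w0: "L2norm M w = 0"
    using L2norm_cong_AE[of w "\<lambda>_. 0" M] w by (simp add: L2_def L2norm_def)
  show ?thesis
  proof (rule Lim_null_comparison[OF _ lim], rule always_eventually, rule allI)
    fix n
    show "norm (L2norm M (T (real n) f)) \<le> L2norm M (\<lambda>z. T (real n) f z - w z)"
      using L2norm_triangle[of M "\<lambda>z. T (real n) f z - w z" w] w f w0 by simp
  qed
qed

text \<open>For \<open>f = x - q\<close> in weak form, put \<open>\<phi>\<close>, \<open>d\<close>,
  \<open>e\<close> as below: \<open>\<phi>\<close> has derivative \<open>- d\<close>,
  \<open>d\<close> has derivative \<open>- e\<close>, and \<open>spectral_gap_form\<close> at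
  \<open>T (t/2) x\<close> reads \<open>\<delta> * d t \<le> e t\<close>. So \<open>d\<close> decays
  at rate \<open>\<delta>\<close>; \<open>e\<close> follows because it is decreasing with integral
  controlled by \<open>d\<close>, and \<open>\<phi>\<close> by integrating \<open>d\<close> back
  from infinity, where \<open>ergodic\<close> gives the value 0.\<close>

lemma exponential_decay:
  assumes \<delta>: "\<delta> > 0" and spec: "spectral_gap M T \<delta>" and f: "L2 M f" and f1: "ip M f (\<lambda>_. 1) = 0"
    and t: "0 \<le> t"
  shows "L2norm M (T t f) \<le> exp (- \<delta> * t) * L2norm M f"
proof -
  have "in_resolvent M T 1" using spec by (simp add: spectral_gap_def)
  then obtain x q where g: "gen x q" and s: "\<And>k. L2 M k \<Longrightarrow> 1 * ip M x k - ip M q k = ip M f k"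
    using resolvent_solve[OF _ f] by blast
  have L: "L2 M x" "L2 M q" using g by auto
  have x1: "ip M x (\<lambda>_. 1) = 0" using s[of "\<lambda>_. 1"] gen_one[OF g] f1 by simp
  define d where "d t = - ip M (T t x) q" for t
  define e where "e t = ip M (T t q) q" for t
  define \<phi> where "\<phi> t = ip M (T t x) x" for t
  have half: "ip M (T t u) v = ip M (T (t/2) u) (T (t/2) v)" if "0 \<le> t" "L2 M u" "L2 M v" for t u v
    using T_split[of "t/2" "t/2" u v] that by simp
  have e_sq: "e t = (L2norm M (T (t/2) q))^2" if "0 \<le> t" for t
    using half[OF that L(2) L(2)] by (simp add: e_def L2norm_sq)
  have \<phi>_sq: "\<phi> t = (L2norm M (T (t/2) x))^2" if "0 \<le> t" for t
    using half[OF that L(1) L(1)] by (simp add: \<phi>_def L2norm_sq)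
  have d_half: "d t = - ip M (T (t/2) q) (T (t/2) x)" if "0 \<le> t" for t
    using half[OF that L(1) L(2)] by (simp add: d_def ip_commute)
  have d_nonneg: "0 \<le> d t" if "0 \<le> t" for t
    using gen_nonpos[OF gen_T[OF g, of "t/2"]] that by (simp add: d_half)
  have e_ge: "\<delta> * d t \<le> e t" if "0 \<le> t" for t
    using spectral_gap_form[OF \<delta> spec gen_T[OF g, of "t/2"]] that by (simp add: d_half e_sq L2norm_sq)
  have e_mono: "e t \<le> e s" if "0 \<le> s" "s \<le> t" for s t
    using that L by (simp add: e_sq power_mono T_mono)
  have d_deriv: "(d has_real_derivative - e t) (at t)" if "0 < t" for t
    unfolding d_def[abs_def] e_def using gen_deriv[OF g L(2) that] by (rule DERIV_minus)
  have \<phi>_deriv: "(\<phi> has_real_derivative - d t) (at t)" if "0 < t" for t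
    using gen_deriv[OF g L(1) that] that L unfolding \<phi>_def[abs_def] d_def
    by (simp add: T_sym ip_commute[of M q])
  \<comment> \<open>The decay starts at time 1, since \<open>gen_deriv\<close> holds only at
    positive times.\<close>
  define C where "C = d 1 * exp \<delta>"
  have C: "0 \<le> C" unfolding C_def using d_nonneg by simp
  have d_dec: "d t \<le> C * exp (- \<delta> * t)" if "t \<ge> 1" for t
  proof -
    have "d t * exp (\<delta> * t) \<le> d 1 * exp (\<delta> * 1)"
    proof (rule DERIV_nonpos_imp_nonincreasing[where f="\<lambda>t. d t * exp (\<delta> * t)", OF that])
      fix s :: real assume s: "1 \<le> s" "s \<le> t"
      have "((\<lambda>t. d t * exp (\<delta> * t)) has_real_derivative (- e s * exp (\<delta> * s) + d s * (exp (\<delta> * s) * \<delta>))) (at s)"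
        using s by (auto intro!: derivative_eq_intros d_deriv)
      moreover have "- e s * exp (\<delta> * s) + d s * (exp (\<delta> * s) * \<delta>) = (\<delta> * d s - e s) * exp (\<delta> * s)"
        by (simp add: algebra_simps)
      moreover have "\<dots> \<le> 0" using e_ge[of s] s by (intro mult_nonpos_nonneg) auto
      ultimately show "\<exists>y. ((\<lambda>t. d t * exp (\<delta> * t)) has_real_derivative y) (at s) \<and> y \<le> 0" by metis
    qed
    then show ?thesis by (simp add: C_def exp_minus field_simps)
  qed
  have e_dec: "e t \<le> C * exp \<delta> * exp (- \<delta> * t)" if t: "t \<ge> 2" for t
  proof -
    \<comment> \<open>The drop of \<open>d\<close> over a unit interval equals \<open>e z\<close>;
      monotonicity of \<open>e\<close> then gives \<open>e t \<le> d (t - 1)\<close>.\<close>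
    obtain z where z: "t - 1 < z" "z < t" "d t - d (t - 1) = (t - (t - 1)) * (- e z)"
      using MVT2[of "t - 1" t d "\<lambda>s. - e s"] d_deriv t by force
    have "e t \<le> e z" using z t by (intro e_mono) auto
    also have "\<dots> \<le> d (t - 1)" using z d_nonneg[of t] t by simp
    also have "\<dots> \<le> C * exp (- \<delta> * (t - 1))" using t by (intro d_dec) simp
    also have "\<dots> = C * exp \<delta> * exp (- \<delta> * t)"
      by (simp add: mult.assoc exp_add[symmetric]) (simp add: algebra_simps)
    finally show ?thesis .
  qed
  have \<phi>_dec: "\<phi> t \<le> C / \<delta> * exp (- \<delta> * t)" if t: "t \<ge> 1" for t
  proof -
    \<comment> \<open>\<open>\<phi> t\<close> minus the claimed bound is nondecreasing in
      \<open>t\<close>; comparing with \<open>s = 2 * real n\<close> and letting \<open>n\<close>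
      grow shows that it is at most 0.\<close>
    have le: "\<phi> t - C / \<delta> * exp (- \<delta> * t) \<le> \<phi> s" if "t \<le> s" for s
    proof -
      have "\<phi> t - C / \<delta> * exp (- \<delta> * t) \<le> \<phi> s - C / \<delta> * exp (- \<delta> * s)"
      proof (rule DERIV_nonneg_imp_nondecreasing[where f="\<lambda>t. \<phi> t - C / \<delta> * exp (- \<delta> * t)", OF that])
        fix r :: real assume r: "t \<le> r" "r \<le> s"
        have "((\<lambda>t. \<phi> t - C / \<delta> * exp (- \<delta> * t)) has_real_derivative (- d r + C * exp (- \<delta> * r))) (at r)"
          using r t \<delta> by (auto intro!: derivative_eq_intros \<phi>_deriv)
        moreover have "- d r + C * exp (- \<delta> * r) \<ge> 0" using d_dec[of r] r t by simp
        ultimately show "\<exists>y. ((\<lambda>t. \<phi> t - C / \<delta> * exp (- \<delta> * t)) has_real_derivative y) (at r) \<and> y \<ge> 0" by blast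
      qed
      moreover have "0 \<le> C / \<delta> * exp (- \<delta> * s)" using C \<delta> by simp
      ultimately show ?thesis by simp
    qed
    have "(\<lambda>n. (L2norm M (T (real n) x))^2) \<longlonglongrightarrow> 0^2"
    proof (intro tendsto_power ergodic[OF L(1) x1])
      fix x q assume "gen x q" "AE z in M. q z = 0"
      then show "\<exists>c. AE z in M. x z = c" using spec unfolding spectral_gap_def by blast
    qed
    then have "\<phi> t - C / \<delta> * exp (- \<delta> * t) \<le> 0^2"
    proof (rule tendsto_lowerbound)
      show "\<forall>\<^sub>F n in sequentially. \<phi> t - C / \<delta> * exp (- \<delta> * t) \<le> (L2norm M (T (real n) x))^2"
        using eventually_ge_at_top[of "nat \<lceil>t\<rceil>"]
      proof eventually_elim
        case (elim n)
        then have "t \<le> 2 * real n" by linarith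
        from le[OF this] show ?case by (simp add: \<phi>_sq)
      qed
    qed simp
    then show ?thesis by simp
  qed
  show ?thesis
  \<comment> \<open>Squared norms at time \<open>t\<close> are \<open>\<phi>\<close> and
    \<open>e\<close> at time \<open>2 * t\<close>; for \<open>t \<ge> 1\<close> this lies in the
    range \<open>\<ge> 2\<close> of \<open>e_dec\<close>, and taking roots halves the rate of decay
    in \<open>2 * t\<close> to the required one in \<open>t\<close>.\<close>
  proof (rule decay_sharp[OF f _ t, where ?t0.0=1 and C="sqrt (C / \<delta>) + sqrt (C * exp \<delta>)"])
    fix t :: real assume t: "1 \<le> t"
    have sq: "exp (- \<delta> * (2 * t)) = (exp (- \<delta> * t))^2"
      by (simp add: power2_eq_square exp_add[symmetric])
    have n1: "L2norm M (T t x) \<le> sqrt (C / \<delta>) * exp (- \<delta> * t)"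
    proof (rule power2_le_imp_le)
      show "(L2norm M (T t x))^2 \<le> (sqrt (C / \<delta>) * exp (- \<delta> * t))^2"
        using \<phi>_dec[of "2 * t"] t C \<delta> unfolding sq by (simp add: \<phi>_sq power_mult_distrib)
    qed (use C \<delta> in simp)
    have n2: "L2norm M (T t q) \<le> sqrt (C * exp \<delta>) * exp (- \<delta> * t)"
    proof (rule power2_le_imp_le)
      show "(L2norm M (T t q))^2 \<le> (sqrt (C * exp \<delta>) * exp (- \<delta> * t))^2"
        using e_dec[of "2 * t"] t C unfolding sq by (simp add: e_sq power_mult_distrib)
    qed (use C in simp)
    have "L2norm M (T t f) \<le> L2norm M (T t x) + L2norm M (T t q)"
    proof (rule L2norm_le_dual)
      fix k assume k: "L2 M k"
      have "ip M (T t f) k = ip M (T t x) k - ip M (T t q) k"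
        using s[of "T t k"] t k f L by (simp add: T_sym)
      also have "\<dots> \<le> L2norm M (T t x) * L2norm M k + L2norm M (T t q) * L2norm M k"
        using ip_Cauchy_Schwarz[of M "T t x" k] ip_Cauchy_Schwarz[of M "T t q" k] t k L by (simp add: abs_le_iff)
      finally show "ip M (T t f) k \<le> (L2norm M (T t x) + L2norm M (T t q)) * L2norm M k"
        by (simp add: distrib_right)
    qed (use t f in auto)
    also have "\<dots> \<le> (sqrt (C / \<delta>) + sqrt (C * exp \<delta>)) * exp (- \<delta> * t)"
      using n1 n2 by (simp add: distrib_right)
    finally show "L2norm M (T t f) \<le> (sqrt (C / \<delta>) + sqrt (C * exp \<delta>)) * exp (- \<delta> * t)" .
  qed
qed

end

subsection \<open>Reversible Markov processes\<close>

locale reversible_markov = prob_space P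
  for P :: "(real \<Rightarrow> 's) measure" +
  fixes \<pi> :: "'s measure" and T :: "real \<Rightarrow> ('s \<Rightarrow> real) \<Rightarrow> ('s \<Rightarrow> real)"
  assumes prob_pi: "prob_space \<pi>"
    and sets_P: "sets P = sets (path_space \<pi>)"
    and stationary_P: "stationary P \<pi>"
    and markov_P: "markov P \<pi> T"
    and symmetric_T: "symmetric_C0 \<pi> T"
begin

sublocale S: prob_space \<pi> by (rule prob_pi)

lemma space_P: "space P = (UNIV \<rightarrow>\<^sub>E space \<pi>)"
  using sets_eq_imp_space_eq[OF sets_P] by (simp add: space_PiM)

lemma coord_in_space [simp]: "\<omega> \<in> space P \<Longrightarrow> \<omega> t \<in> space \<pi>"
  by (auto simp: space_P)

lemma measurable_coord [measurable]: "(\<lambda>\<omega>. \<omega> t) \<in> measurable P \<pi>"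
  unfolding measurable_cong_sets[OF sets_P refl] by (rule measurable_component_singleton) simp

lemma distr_coord: "distr P \<pi> (\<lambda>\<omega>. \<omega> t) = \<pi>"
  using stationary_P by (simp add: stationary_def)

lemma integral_coord:
  fixes f :: "'s \<Rightarrow> real"
  assumes "f \<in> borel_measurable \<pi>"
  shows "(\<integral>\<omega>. f (\<omega> t) \<partial>P) = (\<integral>x. f x \<partial>\<pi>)"
  using integral_distr[OF measurable_coord, of f t] assms by (simp add: distr_coord)

lemma L2_coord:
  assumes "L2 \<pi> f"
  shows "L2 P (\<lambda>\<omega>. f (\<omega> t))"
proof -
  have [measurable]: "f \<in> borel_measurable \<pi>" using assms by (rule L2_meas)
  have "integrable (distr P \<pi> (\<lambda>\<omega>. \<omega> t)) (\<lambda>x. (f x)^2)"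
    using assms by (simp add: distr_coord L2_def)
  then have "integrable P (\<lambda>\<omega>. (f (\<omega> t))^2)"
    by (subst (asm) integrable_distr_eq) auto
  then show ?thesis by (simp add: L2_def)
qed

lemma ip_coord:
  assumes "f \<in> borel_measurable \<pi>" "g \<in> borel_measurable \<pi>"
  shows "ip P (\<lambda>\<omega>. f (\<omega> t)) (\<lambda>\<omega>. g (\<omega> t)) = ip \<pi> f g"
  unfolding ip_def using assms by (intro integral_coord) measurable

lemma L2norm_coord: "f \<in> borel_measurable \<pi> \<Longrightarrow> L2norm P (\<lambda>\<omega>. f (\<omega> t)) = L2norm \<pi> f"
  by (simp add: L2norm_ip ip_coord)

section \<open>The coordinate sigma-algebras and the Markov property\<close>

definition filt :: "real set \<Rightarrow> (real \<Rightarrow> 's) measure" where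
  "filt I = sigma (space P) (\<Union>t\<in>I. {(\<lambda>\<omega>. \<omega> t) -` B \<inter> space P | B. B \<in> sets \<pi>})"

lemma filt_gen_Pow: "(\<Union>t\<in>I. {(\<lambda>\<omega>. \<omega> t) -` B \<inter> space P | B. B \<in> sets \<pi>}) \<subseteq> Pow (space P)"
  by auto

lemma sets_filt: "sets (filt I) = coord_sigma P \<pi> I"
  unfolding filt_def coord_sigma_def by (rule sets_measure_of[OF filt_gen_Pow])

lemma space_filt [simp]: "space (filt I) = space P"
  unfolding filt_def by (rule space_measure_of[OF filt_gen_Pow])

lemma filt_mono: "I \<subseteq> J \<Longrightarrow> sets (filt I) \<subseteq> sets (filt J)"
  unfolding sets_filt coord_sigma_def by (intro sigma_sets_mono') auto

lemma measurable_coord_filt: "t \<in> I \<Longrightarrow> (\<lambda>\<omega>. \<omega> t) \<in> measurable (filt I) \<pi>"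
  by (rule measurableI) (auto simp: sets_filt coord_sigma_def intro!: sigma_sets.Basic)

lemma subalgebra_filt: "subalgebra P (filt I)"
  unfolding subalgebra_def
proof
  show "sets (filt I) \<subseteq> sets P"
    unfolding sets_filt coord_sigma_def by (rule sets.sigma_sets_subset) auto
qed simp

lemma sets_filt_P: "E \<in> sets (filt I) \<Longrightarrow> E \<in> sets P"
  using subalgebra_filt[of I] by (auto simp: subalgebra_def)

lemma measurable_filt_P: "Y \<in> borel_measurable (filt I) \<Longrightarrow> Y \<in> borel_measurable P"
  by (rule measurable_from_subalg[OF subalgebra_filt])

lemma markov_step:
  assumes "0 \<le> s" "L2 \<pi> f" "E \<in> sets (filt {..t})"
  shows "(\<integral>\<omega>. indicator E \<omega> * f (\<omega> (t + s)) \<partial>P) = (\<integral>\<omega>. indicator E \<omega> * T s f (\<omega> t) \<partial>P)"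
  using markov_P assms unfolding markov_def sets_filt by blast

lemma T_L2_of_symmetric: "0 \<le> t \<Longrightarrow> L2 \<pi> f \<Longrightarrow> L2 \<pi> (T t f)"
  using symmetric_T by (simp add: symmetric_C0_def)

text \<open>The event form of \<open>markov\<close> identifies \<open>T s f\<close> at time
  \<open>t\<close> as the conditional expectation given the past; hence events may be replaced by
  square integrable functions of the past.\<close>

lemma markov_past:
  assumes s: "0 \<le> s" and f: "L2 \<pi> f" and H: "H \<in> borel_measurable (filt {..t})" "L2 P H"
  shows "ip P H (\<lambda>\<omega>. f (\<omega> (t + s))) = ip P H (\<lambda>\<omega>. T s f (\<omega> t))"
proof -
  interpret sigma_finite_subalgebra P "filt {..t}"
    by (rule finite_measure_subalgebra_is_sigma_finite)
      (simp add: finite_measure_subalgebra_def finite_measure_axioms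
        finite_measure_subalgebra_axioms_def subalgebra_filt)
  have L: "L2 P (\<lambda>\<omega>. f (\<omega> (t + s)))" "L2 P (\<lambda>\<omega>. T s f (\<omega> t))"
    using s f by (auto intro!: L2_coord T_L2_of_symmetric)
  have [measurable]: "T s f \<in> borel_measurable \<pi>" "f \<in> borel_measurable \<pi>"
    using s f by (auto intro: L2_meas T_L2_of_symmetric)
  have AE: "AE \<omega> in P. real_cond_exp P (filt {..t}) (\<lambda>\<omega>. f (\<omega> (t + s))) \<omega> = T s f (\<omega> t)"
  proof (rule real_cond_exp_charact)
    fix A assume "A \<in> sets (filt {..t})"
    from markov_step[OF s f this]
    show "(\<integral>\<omega>\<in>A. f (\<omega> (t + s)) \<partial>P) = (\<integral>\<omega>\<in>A. T s f (\<omega> t) \<partial>P)"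
      by (simp add: set_lebesgue_integral_def)
  next
    show "(\<lambda>\<omega>. T s f (\<omega> t)) \<in> borel_measurable (filt {..t})"
      by (rule measurable_compose[OF measurable_coord_filt]) auto
  qed (use L in \<open>auto intro: L2_integrable\<close>)
  have "ip P H (\<lambda>\<omega>. f (\<omega> (t + s))) = (\<integral>\<omega>. H \<omega> * real_cond_exp P (filt {..t}) (\<lambda>\<omega>. f (\<omega> (t + s))) \<omega> \<partial>P)"
    unfolding ip_def
    by (rule real_cond_exp_intg(2)[symmetric]) (use H L in \<open>auto intro: L2_integrable_mult\<close>)
  also have "\<dots> = (\<integral>\<omega>. H \<omega> * T s f (\<omega> t) \<partial>P)"
    by (rule integral_cong_AE) (use AE H measurable_filt_P[OF H(1)] in \<open>auto\<close>)
  finally show ?thesis by (simp add: ip_def)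
qed

text \<open>Translates inner products with \<open>T s f\<close> into expectations over paths; the
  laws of \<open>T\<close> are read off from it.\<close>

lemma two_time:
  assumes "0 \<le> s" "L2 \<pi> f" "L2 \<pi> h"
  shows "ip P (\<lambda>\<omega>. h (\<omega> t)) (\<lambda>\<omega>. f (\<omega> (t + s))) = ip \<pi> h (T s f)"
proof -
  have m: "h \<in> borel_measurable \<pi>" "T s f \<in> borel_measurable \<pi>"
    using assms by (auto intro: L2_meas T_L2_of_symmetric)
  have "(\<lambda>\<omega>. h (\<omega> t)) \<in> borel_measurable (filt {..t})"
    by (rule measurable_compose[OF measurable_coord_filt m(1)]) simp
  from markov_past[OF assms(1,2) this L2_coord[OF assms(3)]] show ?thesis
    using m by (simp add: ip_coord)
qed

text \<open>Contractivity is Cauchy-Schwarz on path space, where stationarity gives both factors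
  their norms in \<open>L2 \<pi>\<close>; conservation of the mean is the case of a constant first
  factor; the semigroup law comes from conditioning at the intermediate time
  \<open>s\<close>.\<close>

sublocale SG: symmetric_semigroup \<pi> T
proof
  fix t :: real and f assume t: "0 \<le> t" and f: "L2 \<pi> f"
  show Tf: "L2 \<pi> (T t f)" by (rule T_L2_of_symmetric[OF t f])
  show "ip \<pi> (T t f) g = ip \<pi> f (T t g)" if "L2 \<pi> g" for g
    using symmetric_T t f that unfolding symmetric_C0_def ip_def by blast
  show "L2norm \<pi> (T t f) \<le> L2norm \<pi> f"
  proof (rule L2norm_le_dual[OF Tf])
    fix g assume g: "L2 \<pi> g"
    have "ip \<pi> (T t f) g = ip P (\<lambda>\<omega>. g (\<omega> 0)) (\<lambda>\<omega>. f (\<omega> (0 + t)))"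
      using two_time[OF t f g, of 0] by (simp add: ip_commute)
    also have "\<dots> \<le> L2norm P (\<lambda>\<omega>. g (\<omega> 0)) * L2norm P (\<lambda>\<omega>. f (\<omega> (0 + t)))"
      using f g by (intro ip_le_norms L2_coord)
    also have "\<dots> = L2norm \<pi> f * L2norm \<pi> g"
      using f g by (simp add: L2norm_coord L2_meas)
    finally show "ip \<pi> (T t f) g \<le> L2norm \<pi> f * L2norm \<pi> g" .
  qed simp
  show "ip \<pi> (T t f) (\<lambda>_. 1) = ip \<pi> f (\<lambda>_. 1)"
  proof -
    have "ip \<pi> (T t f) (\<lambda>_. 1) = ip P (\<lambda>\<omega>. 1) (\<lambda>\<omega>. f (\<omega> (0 + t)))"
      using two_time[OF t f, of "\<lambda>_. 1" 0] by (simp add: ip_commute)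
    also have "\<dots> = ip \<pi> f (\<lambda>_. 1)"
      using integral_coord[OF L2_meas[OF f]] by (simp add: ip_def)
    finally show ?thesis .
  qed
next
  fix s t :: real and f g assume st: "0 \<le> s" "0 \<le> t" and f: "L2 \<pi> f" and g: "L2 \<pi> g"
  have "ip \<pi> g (T (s + t) f) = ip P (\<lambda>\<omega>. g (\<omega> 0)) (\<lambda>\<omega>. f (\<omega> (s + t)))"
    using two_time[of "s + t" f g 0] st f g by simp
  also have "\<dots> = ip P (\<lambda>\<omega>. g (\<omega> 0)) (\<lambda>\<omega>. T t f (\<omega> s))"
    by (rule markov_past[OF st(2) f _ L2_coord[OF g]])
      (rule measurable_compose[OF measurable_coord_filt L2_meas[OF g]], use st in simp)
  also have "\<dots> = ip \<pi> g (T s (T t f))"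
    using two_time[OF st(1) T_L2_of_symmetric[OF st(2) f] g, of 0] by simp
  finally show "ip \<pi> (T s (T t f)) g = ip \<pi> (T (s + t) f) g"
    by (simp add: ip_commute)
next
  fix f assume "L2 \<pi> f"
  then show "((\<lambda>h. L2norm \<pi> (\<lambda>x. T h f x - f x)) \<longlongrightarrow> 0) (at_right 0)"
    using symmetric_T by (simp add: symmetric_C0_def)
qed

text \<open>\<open>u\<close> is a version of the conditional probability of \<open>E\<close> given the state at time \<open>t\<close>.\<close>
definition dens :: "real \<Rightarrow> (real \<Rightarrow> 's) set \<Rightarrow> ('s \<Rightarrow> real) \<Rightarrow> bool" where
  "dens t E u \<longleftrightarrow> u \<in> borel_measurable \<pi> \<and> (\<forall>x. 0 \<le> u x \<and> u x \<le> 1) \<and>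
     (\<forall>f\<in>borel_measurable \<pi>. (\<integral>\<omega>. indicator E \<omega> * f (\<omega> t) \<partial>P) = (\<integral>x. u x * f x \<partial>\<pi>))"

text \<open>\<open>u\<close> is the Radon-Nikodym density of the law of the state at time
  \<open>t\<close> restricted to \<open>E\<close>. This law lies below \<open>\<pi>\<close>, so the
  density is at most 1 almost everywhere.\<close>

lemma dens_exists:
  assumes E [measurable]: "E \<in> sets P"
  shows "\<exists>u. dens t E u"
proof -
  define \<nu> where "\<nu> = distr (density P (\<lambda>\<omega>. ennreal (indicator E \<omega>))) \<pi> (\<lambda>\<omega>. \<omega> t)"
  have coord': "(\<lambda>\<omega>. \<omega> t) \<in> measurable (density P (\<lambda>\<omega>. ennreal (indicator E \<omega>))) \<pi>" by simp
  have le: "emeasure \<nu> B \<le> emeasure \<pi> B" if [measurable]: "B \<in> sets \<pi>" for B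
  proof -
    have "emeasure \<nu> B = (\<integral>\<^sup>+\<omega>. ennreal (indicator E \<omega>) * indicator ((\<lambda>\<omega>. \<omega> t) -` B \<inter> space P) \<omega> \<partial>P)"
      unfolding \<nu>_def by (subst emeasure_distr[OF coord']) (auto simp: emeasure_density)
    also have "\<dots> \<le> (\<integral>\<^sup>+\<omega>. indicator ((\<lambda>\<omega>. \<omega> t) -` B \<inter> space P) \<omega> \<partial>P)"
      by (intro nn_integral_mono) (auto simp: indicator_def)
    also have "\<dots> = emeasure P ((\<lambda>\<omega>. \<omega> t) -` B \<inter> space P)" by simp
    also have "\<dots> = emeasure (distr P \<pi> (\<lambda>\<omega>. \<omega> t)) B" by (simp add: emeasure_distr)
    finally show ?thesis by (simp add: distr_coord)
  qed
  have sets_\<nu>: "sets \<nu> = sets \<pi>" unfolding \<nu>_def by simp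
  have ac: "absolutely_continuous \<pi> \<nu>"
    unfolding absolutely_continuous_def
  proof
    fix B assume "B \<in> null_sets \<pi>"
    then have "B \<in> sets \<pi>" "emeasure \<pi> B = 0" by auto
    then show "B \<in> null_sets \<nu>"
      using le[of B] sets_\<nu> by (auto intro!: null_setsI)
  qed
  obtain g where g [measurable]: "g \<in> borel_measurable \<pi>" and dg: "density \<pi> g = \<nu>"
    using S.Radon_Nikodym[OF ac sets_\<nu>] by blast
  define B where "B = {x \<in> space \<pi>. 1 < g x}"
  have [measurable]: "B \<in> sets \<pi>" unfolding B_def by measurable
  \<comment> \<open>On \<open>B\<close> the excess \<open>g - 1\<close> is positive, yet its
    integral is \<open>\<nu>\<close> of \<open>B\<close> minus \<open>\<pi>\<close> of
    \<open>B\<close>, which truncates to 0.\<close>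
  have g1: "AE x in \<pi>. g x \<le> 1"
  proof -
    have fin: "(\<integral>\<^sup>+x. indicator B x \<partial>\<pi>) \<noteq> \<infinity>"
      using S.emeasure_finite[of B] by simp
    have "(\<integral>\<^sup>+x. (g x * indicator B x) - indicator B x \<partial>\<pi>)
        = (\<integral>\<^sup>+x. g x * indicator B x \<partial>\<pi>) - (\<integral>\<^sup>+x. indicator B x \<partial>\<pi>)"
      by (rule nn_integral_diff) (use fin in \<open>auto simp: B_def indicator_def intro!: AE_I2\<close>)
    also have "(\<integral>\<^sup>+x. g x * indicator B x \<partial>\<pi>) = emeasure \<nu> B"
      unfolding dg[symmetric] by (simp add: emeasure_density)
    also have "emeasure \<nu> B - (\<integral>\<^sup>+x. indicator B x \<partial>\<pi>) = 0"
    proof -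
      have "emeasure \<nu> B \<noteq> \<top>" using le[of B] S.emeasure_finite[of B] by (auto simp: top_unique)
      then show ?thesis using le[of B] by (simp add: diff_eq_0_iff_ennreal less_top[symmetric])
    qed
    finally have "AE x in \<pi>. (g x * indicator B x) - indicator B x = 0"
      by (subst (asm) nn_integral_0_iff_AE) auto
    then show ?thesis
    proof (rule AE_mp, intro AE_I2 impI)
      fix x assume "x \<in> space \<pi>" "g x * indicator B x - indicator B x = 0"
      then show "g x \<le> 1"
        by (cases "1 < g x") (auto simp: B_def diff_eq_0_iff_ennreal)
    qed
  qed
  \<comment> \<open>Truncation at 1 makes the bound hold everywhere without changing the density
    almost everywhere.\<close>
  define u where "u x = enn2real (min 1 (g x))" for x
  have [measurable]: "u \<in> borel_measurable \<pi>" unfolding u_def[abs_def] by measurable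
  have fin: "min 1 (g x) < \<top>" for x by (simp add: min_less_iff_disj)
  have u01: "0 \<le> u x" "u x \<le> 1" for x
    unfolding u_def using enn2real_mono[of "min 1 (g x)" 1] by auto
  have "density \<pi> (\<lambda>x. ennreal (u x)) = \<nu>"
    unfolding dg[symmetric]
  proof (rule density_cong)
    show "AE x in \<pi>. ennreal (u x) = g x"
      using g1
    proof eventually_elim
      case (elim x)
      then show ?case using fin[of x] by (simp add: u_def min_absorb2)
    qed
  qed measurable
  \<comment> \<open>Image and density formulas hold for every measurable \<open>f\<close>, so
    \<open>dens\<close> can quantify over all of them without integrability.\<close>
  moreover have "(\<integral>\<omega>. indicator E \<omega> * f (\<omega> t) \<partial>P) = (\<integral>x. f x \<partial>\<nu>)"
    if [measurable]: "f \<in> borel_measurable \<pi>" for f :: "'s \<Rightarrow> real"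
  proof -
    have "(\<integral>x. f x \<partial>\<nu>) = (\<integral>\<omega>. f (\<omega> t) \<partial>density P (\<lambda>\<omega>. ennreal (indicator E \<omega>)))"
      unfolding \<nu>_def by (rule integral_distr[OF coord' that])
    also have "\<dots> = (\<integral>\<omega>. indicator E \<omega> *\<^sub>R f (\<omega> t) \<partial>P)"
      by (rule integral_density) auto
    finally show ?thesis by simp
  qed
  moreover have "(\<integral>x. f x \<partial>density \<pi> (\<lambda>x. ennreal (u x))) = (\<integral>x. u x * f x \<partial>\<pi>)"
    if "f \<in> borel_measurable \<pi>" for f :: "'s \<Rightarrow> real"
    using integral_density[OF that, of u] u01 by simp
  ultimately show ?thesis
    unfolding dens_def using u01 by (intro exI[of _ u]) auto
qed

lemma dens_L2: "dens t E u \<Longrightarrow> L2 \<pi> u"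
  by (rule S.L2_bounded[where B=1]) (auto simp: dens_def abs_le_iff intro: order_trans[of _ 0])

lemma densD: "dens t E u \<Longrightarrow> f \<in> borel_measurable \<pi> \<Longrightarrow> (\<integral>\<omega>. indicator E \<omega> * f (\<omega> t) \<partial>P) = ip \<pi> u f"
  by (simp add: dens_def ip_def)

lemma dens_one:
  assumes "dens t E u" "E \<in> sets P"
  shows "ip \<pi> u (\<lambda>_. 1) = prob E"
  using densD[OF assms(1), of "\<lambda>_. 1"] assms(2) by simp

section \<open>Conditional independence of past and future given the present\<close>

definition cyl :: "real set \<Rightarrow> (real \<Rightarrow> 's set) \<Rightarrow> (real \<Rightarrow> 's) set" where
  "cyl J B = {\<omega> \<in> space P. \<forall>j\<in>J. \<omega> j \<in> B j}"

lemma cyl_filt: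
  assumes "finite J" "J \<subseteq> I" "\<And>j. j \<in> J \<Longrightarrow> B j \<in> sets \<pi>"
  shows "cyl J B \<in> sets (filt I)"
proof -
  have "{\<omega> \<in> space (filt I). \<omega> j \<in> B j} \<in> sets (filt I)" if "j \<in> J" for j
    using measurable_sets[OF measurable_coord_filt[of j I] assms(3)[OF that]] that assms(2)
    by (auto simp: vimage_def Int_def conj_commute)
  then have "{\<omega> \<in> space (filt I). \<forall>j\<in>J. \<omega> j \<in> B j} \<in> sets (filt I)"
    by (intro sets.sets_Collect_finite_All assms(1)) auto
  then show ?thesis by (simp add: cyl_def)
qed

text \<open>\<open>markov\<close> speaks of one future time only. Several times are reached by
  inserting the earliest one, \<open>b\<close>: multiply the function for the later times by the
  indicator of \<open>B b\<close> and transport it from \<open>b\<close> to \<open>t\<close> with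
  \<open>T (b - t)\<close>. The result serves all past events \<open>E\<close> at once.\<close>

lemma cyl_future:
  assumes "finite J"
  shows "(\<forall>j\<in>J. t \<le> j) \<Longrightarrow> (\<forall>j\<in>J. B j \<in> sets \<pi>) \<Longrightarrow>
    \<exists>g. L2 \<pi> g \<and> (\<forall>E\<in>sets (filt {..t}). prob (E \<inter> cyl J B) = (\<integral>\<omega>. indicator E \<omega> * g (\<omega> t) \<partial>P))"
  using assms
proof (induction J arbitrary: t rule: finite_linorder_min_induct)
  case empty
  have "prob (E \<inter> cyl {} B) = (\<integral>\<omega>. indicator E \<omega> * 1 \<partial>P)" if "E \<in> sets (filt {..t})" for E
  proof -
    have "E \<inter> cyl {} B = E" using sets.sets_into_space[OF that] by (auto simp: cyl_def)
    then show ?thesis using sets_filt_P[OF that] by simp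
  qed
  then show ?case by (intro exI[of _ "\<lambda>_. 1"]) auto
next
  case (insert b J)
  have [measurable]: "B b \<in> sets \<pi>" using insert.prems by simp
  have "\<exists>g. L2 \<pi> g \<and> (\<forall>E\<in>sets (filt {..b}). prob (E \<inter> cyl J B) = (\<integral>\<omega>. indicator E \<omega> * g (\<omega> b) \<partial>P))"
    using insert.hyps insert.prems by (intro insert.IH) (auto intro: less_imp_le)
  then obtain g where g: "L2 \<pi> g"
    and gE: "\<And>E. E \<in> sets (filt {..b}) \<Longrightarrow> prob (E \<inter> cyl J B) = (\<integral>\<omega>. indicator E \<omega> * g (\<omega> b) \<partial>P)"
    by blast
  define h where "h x = indicator (B b) x * g x" for x
  have h: "L2 \<pi> h"
  proof -
    have "integrable \<pi> (\<lambda>x. indicator (B b) x * (g x)^2)"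
      using integrable_mult_indicator[OF _ L2_integrable_sq[OF g], of "B b"] by simp
    moreover have "(\<lambda>x. indicator (B b) x * (g x)^2) = (\<lambda>x. (h x)^2)"
      by (auto simp: h_def indicator_def fun_eq_iff)
    ultimately show ?thesis using L2_meas[OF g] unfolding L2_def h_def[abs_def] by simp
  qed
  have tb: "t \<le> b" using insert.prems by simp
  have "prob (E \<inter> cyl (insert b J) B) = (\<integral>\<omega>. indicator E \<omega> * T (b - t) h (\<omega> t) \<partial>P)"
    if E: "E \<in> sets (filt {..t})" for E
  proof -
    define E' where "E' = E \<inter> cyl {b} B"
    have "E \<in> sets (filt {..b})" using E filt_mono[of "{..t}" "{..b}"] tb by auto
    then have E': "E' \<in> sets (filt {..b})" unfolding E'_def
      by (intro sets.Int cyl_filt) auto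
    have "E \<inter> cyl (insert b J) B = E' \<inter> cyl J B"
      unfolding E'_def cyl_def by auto
    then have "prob (E \<inter> cyl (insert b J) B) = (\<integral>\<omega>. indicator E' \<omega> * g (\<omega> b) \<partial>P)"
      using gE[OF E'] by simp
    also have "\<dots> = (\<integral>\<omega>. indicator E \<omega> * h (\<omega> b) \<partial>P)"
      by (rule Bochner_Integration.integral_cong) (auto simp: E'_def cyl_def h_def indicator_def)
    also have "\<dots> = (\<integral>\<omega>. indicator E \<omega> * T (b - t) h (\<omega> t) \<partial>P)"
      using markov_step[OF _ h E, of "b - t"] tb by simp
    finally show ?thesis .
  qed
  moreover have "L2 \<pi> (T (b - t) h)" using tb h by (intro T_L2_of_symmetric) auto
  ultimately show ?case by blast
qed

text \<open>The function \<open>g\<close> predicting the cylinder from the past and the density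
  \<open>w\<close> of the cylinder at time \<open>t\<close> agree almost everywhere, since both give
  the same integrals over events at time \<open>t\<close>. So both sides equal the inner product of
  \<open>u\<close> and \<open>w\<close>.\<close>

lemma cyl_indep:
  assumes E: "E \<in> sets (filt {..t})" and u: "dens t E u"
    and J: "finite J" "J \<subseteq> {t..}" and B: "\<And>j. j \<in> J \<Longrightarrow> B j \<in> sets \<pi>"
  shows "prob (E \<inter> cyl J B) = (\<integral>\<omega>. u (\<omega> t) * indicator (cyl J B) \<omega> \<partial>P)"
proof -
  obtain g where g: "L2 \<pi> g"
    and gE: "\<And>E. E \<in> sets (filt {..t}) \<Longrightarrow> prob (E \<inter> cyl J B) = (\<integral>\<omega>. indicator E \<omega> * g (\<omega> t) \<partial>P)"
  proof -
    have "\<forall>j\<in>J. t \<le> j" "\<forall>j\<in>J. B j \<in> sets \<pi>" using J B by auto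
    from cyl_future[OF J(1) this] show thesis
      by (elim exE conjE) (rule that, assumption, rule bspec)
  qed
  have D: "cyl J B \<in> sets P" by (rule sets_filt_P[OF cyl_filt[OF J B]])
  then obtain w where w: "dens t (cyl J B) w" using dens_exists by blast
  have AE: "AE x in \<pi>. g x = w x"
  proof (rule density_unique_real)
    show "integrable \<pi> g" "integrable \<pi> w"
      using g dens_L2[OF w] by (auto intro: S.L2_integrable)
    fix A assume A: "A \<in> sets \<pi>"
    define E' where "E' = cyl {t} (\<lambda>_. A)"
    have E': "E' \<in> sets (filt {..t})" unfolding E'_def using A by (intro cyl_filt) auto
    have "(\<integral>x\<in>A. g x \<partial>\<pi>) = (\<integral>\<omega>. indicator A (\<omega> t) * g (\<omega> t) \<partial>P)"
      unfolding set_lebesgue_integral_def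
      using integral_coord[of "\<lambda>x. indicator A x * g x" t] A L2_meas[OF g] by simp
    also have "\<dots> = (\<integral>\<omega>. indicator E' \<omega> * g (\<omega> t) \<partial>P)"
      by (rule Bochner_Integration.integral_cong) (auto simp: E'_def cyl_def indicator_def)
    also have "\<dots> = prob (E' \<inter> cyl J B)" using gE[OF E'] by simp
    also have "\<dots> = (\<integral>\<omega>. indicator (E' \<inter> cyl J B) \<omega> \<partial>P)"
      using D sets_filt_P[OF E'] by simp
    also have "\<dots> = (\<integral>\<omega>. indicator (cyl J B) \<omega> * indicator A (\<omega> t) \<partial>P)"
      by (rule Bochner_Integration.integral_cong) (auto simp: E'_def cyl_def indicator_def)
    also have "\<dots> = ip \<pi> w (indicator A)"
      using A by (intro densD[OF w]) simp
    also have "\<dots> = (\<integral>x\<in>A. w x \<partial>\<pi>)"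
      unfolding ip_def set_lebesgue_integral_def by (simp add: mult.commute)
    finally show "(\<integral>x\<in>A. g x \<partial>\<pi>) = (\<integral>x\<in>A. w x \<partial>\<pi>)" .
  qed
  have "prob (E \<inter> cyl J B) = ip \<pi> u g"
    using gE[OF E] densD[OF u L2_meas[OF g]] by simp
  also have "\<dots> = ip \<pi> w u"
    using ip_cong_AE[OF AE g dens_L2[OF w] dens_L2[OF u]] by (simp add: ip_commute)
  also have "\<dots> = (\<integral>\<omega>. indicator (cyl J B) \<omega> * u (\<omega> t) \<partial>P)"
    using densD[OF w, of u] dens_L2[OF u] by (simp add: L2_meas)
  finally show ?thesis by (simp add: mult.commute)
qed

text \<open>The measures with densities \<open>indicator E\<close> and \<open>u (\<omega> t)\<close>
  agree on cylinders over \<open>{t..}\<close>, an intersection-stable generator, hence on the whole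
  future sigma-algebra. Equality of measures gives equality of integrals even for nonintegrable
  \<open>Y\<close>.\<close>

lemma future_integral:
  assumes E: "E \<in> sets (filt {..t})" and u: "dens t E u"
    and Y: "Y \<in> borel_measurable (filt {t..})"
  shows "(\<integral>\<omega>. indicator E \<omega> * Y \<omega> \<partial>P) = (\<integral>\<omega>. u (\<omega> t) * Y \<omega> \<partial>P)"
proof -
  let ?F = "filt {t..}"
  have [measurable]: "E \<in> sets P" "u \<in> borel_measurable \<pi>"
    using E sets_filt_P u by (auto simp: dens_def)
  have u01: "0 \<le> u x" "u x \<le> 1" for x using u by (auto simp: dens_def)
  define M1 where "M1 = density P (\<lambda>\<omega>. ennreal (indicator E \<omega>))"
  define M2 where "M2 = density P (\<lambda>\<omega>. ennreal (u (\<omega> t)))"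
  have sub1: "subalgebra M1 ?F" and sub2: "subalgebra M2 ?F"
    using subalgebra_filt[of "{t..}"] by (auto simp: M1_def M2_def subalgebra_def)
  define G where "G = {cyl J B | J B. finite J \<and> J \<subseteq> {t..} \<and> (\<forall>j\<in>J. B j \<in> sets \<pi>)}"
  have GI: "cyl J B \<in> G" if "finite J" "J \<subseteq> {t..}" "\<And>j. j \<in> J \<Longrightarrow> B j \<in> sets \<pi>" for J B
    using that unfolding G_def by blast
  have spG: "space P \<in> G"
    using GI[of "{}" "\<lambda>_. {}"] by (simp add: cyl_def)
  have GF: "sets ?F = sigma_sets (space P) G"
  proof
    have "(\<Union>s\<in>{t..}. {(\<lambda>\<omega>. \<omega> s) -` B \<inter> space P | B. B \<in> sets \<pi>}) \<subseteq> G"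
    proof safe
      fix s B assume "t \<le> s" "B \<in> sets \<pi>"
      then have "cyl {s} (\<lambda>_. B) \<in> G" by (intro GI) auto
      moreover have "cyl {s} (\<lambda>_. B) = (\<lambda>\<omega>. \<omega> s) -` B \<inter> space P" by (auto simp: cyl_def)
      ultimately show "(\<lambda>\<omega>. \<omega> s) -` B \<inter> space P \<in> G" by simp
    qed
    then show "sets ?F \<subseteq> sigma_sets (space P) G"
      unfolding sets_filt coord_sigma_def by (rule sigma_sets_mono')
    have "G \<subseteq> sets ?F" unfolding G_def using cyl_filt by blast
    then show "sigma_sets (space P) G \<subseteq> sets ?F"
      using sets.sigma_sets_subset[of G ?F] by simp
  qed
  have "restr_to_subalg M1 ?F = restr_to_subalg M2 ?F"
  proof (rule measure_eqI_generator_eq[where E=G and \<Omega>="space P" and A="\<lambda>_. space P"])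
    show "Int_stable G"
    proof (rule Int_stableI)
      fix a b assume "a \<in> G" "b \<in> G"
      then obtain J B J' B' where a: "a = cyl J B" "finite J" "J \<subseteq> {t..}" "\<forall>j\<in>J. B j \<in> sets \<pi>"
        and b: "b = cyl J' B'" "finite J'" "J' \<subseteq> {t..}" "\<forall>j\<in>J'. B' j \<in> sets \<pi>"
        unfolding G_def by blast
      define B'' where "B'' j = (if j \<in> J then if j \<in> J' then B j \<inter> B' j else B j else B' j)" for j
      have "a \<inter> b = cyl (J \<union> J') B''"
        unfolding a(1) b(1) cyl_def B''_def by auto
      moreover have "cyl (J \<union> J') B'' \<in> G"
        using a b by (intro GI) (auto simp: B''_def)
      ultimately show "a \<inter> b \<in> G" by simp
    qed
    show "G \<subseteq> Pow (space P)" unfolding G_def cyl_def by auto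
    show "sets (restr_to_subalg M1 ?F) = sigma_sets (space P) G"
      "sets (restr_to_subalg M2 ?F) = sigma_sets (space P) G"
      using sets_restr_to_subalg[OF sub1] sets_restr_to_subalg[OF sub2] GF by auto
    show "range (\<lambda>_. space P) \<subseteq> G" using spG by simp
    show "(\<Union>i::nat. space P) = space P" by simp
  next
    fix X assume "X \<in> G"
    then obtain J B where X: "X = cyl J B" "finite J" "J \<subseteq> {t..}" "\<And>j. j \<in> J \<Longrightarrow> B j \<in> sets \<pi>"
      unfolding G_def by blast
    have XF: "X \<in> sets ?F" unfolding X(1) by (rule cyl_filt[OF X(2-4)])
    then have [measurable]: "X \<in> sets P" by (rule sets_filt_P)
    have "emeasure M1 X = (\<integral>\<^sup>+\<omega>. ennreal (indicator E \<omega>) * indicator X \<omega> \<partial>P)"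
      unfolding M1_def by (simp add: emeasure_density)
    also have "\<dots> = (\<integral>\<^sup>+\<omega>. indicator (E \<inter> X) \<omega> \<partial>P)"
      by (rule nn_integral_cong) (simp add: indicator_def)
    also have "\<dots> = ennreal (prob (E \<inter> X))"
      by (simp add: emeasure_eq_measure)
    also have "prob (E \<inter> X) = (\<integral>\<omega>. u (\<omega> t) * indicator X \<omega> \<partial>P)"
      unfolding X(1) by (rule cyl_indep[OF E u X(2-4)])
    also have "ennreal \<dots> = (\<integral>\<^sup>+\<omega>. ennreal (u (\<omega> t) * indicator X \<omega>) \<partial>P)"
    proof (rule nn_integral_eq_integral[symmetric])
      show "integrable P (\<lambda>\<omega>. u (\<omega> t) * indicator X \<omega>)"
        by (rule integrable_const_bound[where B=1]) (use u01 in \<open>auto simp: indicator_def\<close>)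
    qed (use u01 in simp)
    also have "\<dots> = (\<integral>\<^sup>+\<omega>. ennreal (u (\<omega> t)) * indicator X \<omega> \<partial>P)"
      by (rule nn_integral_cong) (simp add: indicator_def)
    also have "\<dots> = emeasure M2 X"
      unfolding M2_def by (simp add: emeasure_density)
    finally show "emeasure (restr_to_subalg M1 ?F) X = emeasure (restr_to_subalg M2 ?F) X"
      by (simp add: emeasure_restr_to_subalg[OF sub1 XF] emeasure_restr_to_subalg[OF sub2 XF])
  next
    fix i :: nat
    have sp: "space P \<in> sets ?F" using sets.top[of ?F] by simp
    have "emeasure M1 (space P) = (\<integral>\<^sup>+\<omega>. ennreal (indicator E \<omega>) * indicator (space P) \<omega> \<partial>P)"
      unfolding M1_def by (simp add: emeasure_density)
    also have "\<dots> \<le> (\<integral>\<^sup>+\<omega>. 1 \<partial>P)"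
      by (rule nn_integral_mono) (simp add: indicator_def)
    also have "\<dots> = 1" by (simp add: emeasure_space_1)
    finally show "emeasure (restr_to_subalg M1 ?F) (space P) \<noteq> \<infinity>"
      unfolding emeasure_restr_to_subalg[OF sub1 sp] by (auto simp: top_unique)
  qed
  then have "(\<integral>\<omega>. Y \<omega> \<partial>M1) = (\<integral>\<omega>. Y \<omega> \<partial>M2)"
    using integral_subalgebra2[OF sub1 Y] integral_subalgebra2[OF sub2 Y] by simp
  moreover have "(\<integral>\<omega>. Y \<omega> \<partial>M1) = (\<integral>\<omega>. indicator E \<omega> *\<^sub>R Y \<omega> \<partial>P)"
    unfolding M1_def by (rule integral_density) (use measurable_filt_P[OF Y] in auto)
  moreover have "(\<integral>\<omega>. Y \<omega> \<partial>M2) = (\<integral>\<omega>. u (\<omega> t) *\<^sub>R Y \<omega> \<partial>P)"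
    unfolding M2_def by (rule integral_density) (use measurable_filt_P[OF Y] u01 in auto)
  ultimately show ?thesis by simp
qed

end

subsection \<open>Mixing and the product bound\<close>

locale gapped_markov = reversible_markov P \<pi> T
  for P :: "(real \<Rightarrow> 's) measure" and \<pi> :: "'s measure" and T +
  fixes \<delta> :: real
  assumes \<delta>_pos: "0 < \<delta>" and spectral_gap_T: "spectral_gap \<pi> T \<delta>"
begin

text \<open>By the Markov property and symmetry, \<open>v\<close> is weakly
  \<open>T (a - b) u\<close>; after centring, \<open>exponential_decay\<close> applies.\<close>

lemma dens_decay:
  assumes E: "E \<in> sets (filt {..b})" and ba: "b \<le> a" and u: "dens b E u" and v: "dens a E v"
  shows "L2norm \<pi> (\<lambda>x. v x - prob E) \<le> exp (- \<delta> * (a - b)) * L2norm \<pi> (\<lambda>x. u x - prob E)"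
proof -
  define m where "m = prob E"
  define d where "d = a - b"
  have d: "0 \<le> d" using ba by (simp add: d_def)
  have L: "L2 \<pi> u" "L2 \<pi> v" using u v by (auto intro: dens_L2)
  have u1: "ip \<pi> u (\<lambda>_. 1) = m"
    unfolding m_def by (rule dens_one[OF u sets_filt_P[OF E]])
  have mean0: "ip \<pi> (\<lambda>x. u x - m) (\<lambda>_. 1) = 0"
    using L u1 by (simp add: ip_simps ip_const_left[of \<pi> m])
  show ?thesis
    unfolding m_def[symmetric] d_def[symmetric]
  proof (rule L2norm_le_dual)
    fix f assume f: "L2 \<pi> f"
    have vf: "ip \<pi> v f = ip \<pi> u (T d f)"
    proof -
      have "ip \<pi> v f = (\<integral>\<omega>. indicator E \<omega> * f (\<omega> (b + d)) \<partial>P)"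
        using densD[OF v L2_meas[OF f]] by (simp add: d_def)
      also have "\<dots> = (\<integral>\<omega>. indicator E \<omega> * T d f (\<omega> b) \<partial>P)"
        by (rule markov_step[OF d f E])
      also have "\<dots> = ip \<pi> u (T d f)"
        using d f by (intro densD[OF u]) (auto intro!: L2_meas)
      finally show ?thesis .
    qed
    have "ip \<pi> (\<lambda>x. v x - m) f = ip \<pi> v f - m * ip \<pi> f (\<lambda>_. 1)"
      using L f by (simp add: ip_simps ip_const_left[of \<pi> m])
    also have "\<dots> = ip \<pi> u (T d f) - m * ip \<pi> (T d f) (\<lambda>_. 1)"
      using vf SG.T_one[OF d f] by simp
    also have "\<dots> = ip \<pi> (\<lambda>x. u x - m) (T d f)"
      using L f d by (simp add: ip_simps ip_const_left[of \<pi> m])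
    also have "\<dots> = ip \<pi> (T d (\<lambda>x. u x - m)) f"
      using L f d by (simp add: SG.T_sym)
    also have "\<dots> \<le> L2norm \<pi> (T d (\<lambda>x. u x - m)) * L2norm \<pi> f"
      using L f d by (intro ip_le_norms) auto
    also have "\<dots> \<le> exp (- \<delta> * d) * L2norm \<pi> (\<lambda>x. u x - m) * L2norm \<pi> f"
      using SG.exponential_decay[OF \<delta>_pos spectral_gap_T _ mean0 d] L
      by (intro mult_right_mono) auto
    finally show "ip \<pi> (\<lambda>x. v x - m) f \<le> exp (- \<delta> * d) * L2norm \<pi> (\<lambda>x. u x - m) * L2norm \<pi> f" .
  qed (use L in auto)
qed

text \<open>With the semigroup over the gap written as \<open>(1 - c) \<Pi> + c S\<close>, the function \<open>w\<close> in the proof is \<open>c S u\<close>.\<close>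
lemma mixing:
  assumes E: "E \<in> sets (filt {..b})" and ba: "b \<le> a" and u: "dens b E u"
    and Y: "Y \<in> borel_measurable (filt {a..})" "L2 P Y"
  defines "c \<equiv> exp (- \<delta> * (a - b))"
  shows "(\<integral>\<omega>. indicator E \<omega> * Y \<omega> \<partial>P)
    \<le> (1 - c) * prob E * (\<integral>\<omega>. Y \<omega> \<partial>P) + c * L2norm \<pi> u * L2norm P Y"
proof -
  define m where "m = prob E"
  have EP: "E \<in> sets P" by (rule sets_filt_P[OF E])
  obtain v where v: "dens a E v" using dens_exists[OF EP] by blast
  have L: "L2 \<pi> u" "L2 \<pi> v" using u v by (auto intro: dens_L2)
  have u1: "ip \<pi> u (\<lambda>_. 1) = m" and v1: "ip \<pi> v (\<lambda>_. 1) = m"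
    unfolding m_def by (rule dens_one[OF u EP], rule dens_one[OF v EP])
  define w where "w x = v x - (1 - c) * m" for x
  have w: "L2 \<pi> w" unfolding w_def[abs_def] using L by auto
  have "L2norm \<pi> w \<le> c * L2norm \<pi> u"
  proof (rule power2_le_imp_le)
    \<comment> \<open>Pythagoras: \<open>w\<close> is \<open>v - m\<close> plus the constant
      \<open>c * m\<close>, and \<open>v - m\<close> has mean 0. The same splitting of
      \<open>u\<close> returns the term \<open>c^2 * m^2\<close>.\<close>
    have "ip \<pi> w w = ip \<pi> (\<lambda>x. v x - m) (\<lambda>x. v x - m) + c^2 * m^2"
    proof -
      have sq: "ip \<pi> (\<lambda>x. v x - k) (\<lambda>x. v x - k) = ip \<pi> v v - 2 * k * m + k^2" for k
        using L v1 by (simp add: ip_simps ip_const_left[of \<pi> k] ip_const_right[of \<pi> _ k] power2_eq_square right_diff_distrib)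
      show ?thesis unfolding w_def sq by (simp add: algebra_simps power2_eq_square)
    qed
    also have "ip \<pi> (\<lambda>x. v x - m) (\<lambda>x. v x - m) \<le> c^2 * ip \<pi> (\<lambda>x. u x - m) (\<lambda>x. u x - m)"
      using power_mono[OF dens_decay[OF E ba u v] L2norm_nonneg, of 2]
      by (simp add: L2norm_sq power_mult_distrib c_def m_def)
    also have "ip \<pi> (\<lambda>x. u x - m) (\<lambda>x. u x - m) = ip \<pi> u u - m^2"
      using L u1 by (simp add: ip_simps ip_const_left[of \<pi> m] ip_const_right[of \<pi> _ m] power2_eq_square right_diff_distrib)
    finally show "(L2norm \<pi> w)^2 \<le> (c * L2norm \<pi> u)^2"
      by (simp add: L2norm_sq power_mult_distrib algebra_simps)
  qed (simp add: c_def)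
  then have wY: "ip P (\<lambda>\<omega>. w (\<omega> a)) Y \<le> c * L2norm \<pi> u * L2norm P Y"
    using ip_le_norms[OF L2_coord[OF w, of a] Y(2)] L2norm_coord[OF L2_meas[OF w], of a]
      mult_right_mono[of "L2norm \<pi> w" "c * L2norm \<pi> u" "L2norm P Y"] by simp
  have "(\<integral>\<omega>. indicator E \<omega> * Y \<omega> \<partial>P) = ip P (\<lambda>\<omega>. v (\<omega> a)) Y"
  proof -
    have "E \<in> sets (filt {..a})" using E filt_mono[of "{..b}" "{..a}"] ba by auto
    from future_integral[OF this v Y(1)] show ?thesis by (simp add: ip_def)
  qed
  also have "\<dots> = ip P (\<lambda>\<omega>. (1 - c) * m) Y + ip P (\<lambda>\<omega>. w (\<omega> a)) Y"
    using ip_add_left[OF L2_const[of "(1 - c) * m"] L2_coord[OF w, of a] Y(2)] by (simp add: w_def)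
  also have "ip P (\<lambda>\<omega>. (1 - c) * m) Y = (1 - c) * m * (\<integral>\<omega>. Y \<omega> \<partial>P)"
    by (simp add: ip_def)
  finally show ?thesis using wY by (simp add: m_def)
qed

text \<open>Prepares the induction: \<open>s\<close> will be the root of the probability of the last
  past event, so that \<open>W\<close> factors out of the averaging and the contracting term
  alike.\<close>

lemma mixing_event:
  assumes E: "E \<in> sets (filt {..b})" and ba: "b \<le> a" and u: "dens b E u"
    and Y: "Y \<in> borel_measurable (filt {a..})" "L2 P Y" "0 \<le> (\<integral>\<omega>. Y \<omega> \<partial>P)"
    and W: "prob E \<le> s * W" "L2norm \<pi> u \<le> W"
  defines "c \<equiv> exp (- \<delta> * (a - b))"
  shows "(\<integral>\<omega>. indicator E \<omega> * Y \<omega> \<partial>P) \<le> W * ((1 - c) * s * (\<integral>\<omega>. Y \<omega> \<partial>P) + c * L2norm P Y)"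
proof -
  have c: "0 \<le> c" "c \<le> 1" using \<delta>_pos ba by (auto simp: c_def)
  have "(\<integral>\<omega>. indicator E \<omega> * Y \<omega> \<partial>P)
    \<le> (1 - c) * prob E * (\<integral>\<omega>. Y \<omega> \<partial>P) + c * L2norm \<pi> u * L2norm P Y"
    unfolding c_def by (rule mixing[OF E ba u Y(1,2)])
  also have "\<dots> \<le> (1 - c) * (s * W) * (\<integral>\<omega>. Y \<omega> \<partial>P) + c * W * L2norm P Y"
    using c W Y(3) by (intro add_mono mult_right_mono mult_left_mono) auto
  finally show ?thesis by (simp add: algebra_simps)
qed

lemma L2_indicator: "A \<in> sets P \<Longrightarrow> L2 P (indicator A)"
  by (rule L2_bounded[where B=1]) (auto simp: indicator_def)

lemma L2norm_indicator: "A \<in> sets P \<Longrightarrow> L2norm P (indicator A) = sqrt (prob A)"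
proof -
  assume "A \<in> sets P"
  moreover have "(\<lambda>x. (indicator A x :: real)^2) = indicator A"
    by (auto simp: indicator_def)
  ultimately show ?thesis by (simp add: L2norm_def)
qed

text \<open>The case \<open>Y = indicator A\<close>: its integral is the square of its norm, so one
  root of \<open>prob A\<close> factors out and \<open>(1 - c) * r + c\<close> remains.\<close>

lemma step_prob:
  assumes E: "E \<in> sets (filt {..b})" and ba: "b \<le> a" and u: "dens b E u"
    and A: "A \<in> sets (filt {a..})" and W: "prob E \<le> s * W" "L2norm \<pi> u \<le> W"
  defines "r \<equiv> s * sqrt (prob A)"
  shows "prob (E \<inter> A) \<le> sqrt (prob A) * (W * (r + exp (- \<delta> * (a - b)) * (1 - r)))"
proof -
  have AP [measurable]: "A \<in> sets P" and EP [measurable]: "E \<in> sets P"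
    using A E by (auto intro: sets_filt_P)
  have "prob (E \<inter> A) = (\<integral>\<omega>. indicator (E \<inter> A) \<omega> \<partial>P)" by simp
  also have "\<dots> = (\<integral>\<omega>. indicator E \<omega> * indicator A \<omega> \<partial>P)"
    by (simp add: indicator_inter_arith)
  also have "\<dots> \<le> W * ((1 - exp (- \<delta> * (a - b))) * s * (\<integral>\<omega>. indicator A \<omega> \<partial>P)
      + exp (- \<delta> * (a - b)) * L2norm P (indicator A))"
    using A by (intro mixing_event[OF E ba u _ L2_indicator[OF AP] _ W]) auto
  also have "(\<integral>\<omega>. indicator A \<omega> \<partial>P) = sqrt (prob A) * sqrt (prob A)" by simp
  also have "L2norm P (indicator A) = sqrt (prob A)" by (rule L2norm_indicator[OF AP])
  finally show ?thesis unfolding r_def by (simp only: algebra_simps)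
qed

text \<open>Tests the new density against itself: the squared norm of \<open>u'\<close> is an
  integral over \<open>E \<inter> A\<close>, hence of the form treated by
  \<open>mixing_event\<close>, and one factor of the norm cancels.\<close>

lemma step_dens:
  assumes E: "E \<in> sets (filt {..b})" and ba: "b \<le> a" and u: "dens b E u"
    and A: "A \<in> sets (filt {a..})" and W: "0 \<le> s" "prob E \<le> s * W" "L2norm \<pi> u \<le> W"
    and b': "a \<le> b'" and u': "dens b' (E \<inter> A) u'"
  defines "r \<equiv> s * sqrt (prob A)"
  shows "L2norm \<pi> u' \<le> W * (r + exp (- \<delta> * (a - b)) * (1 - r))"
proof (cases "L2norm \<pi> u' = 0")
  case True
  have "0 \<le> W" using W(3) L2norm_nonneg[of \<pi> u] by linarith
  moreover have "0 \<le> r" unfolding r_def using W(1) by simp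
  moreover have "0 \<le> exp (- \<delta> * (a - b))" "exp (- \<delta> * (a - b)) \<le> 1" using \<delta>_pos ba by auto
  \<comment> \<open>For a vanishing norm only the sign of the right side matters; it is
    \<open>W\<close> times a convex combination of \<open>r\<close> and 1.\<close>
  ultimately have "0 \<le> (1 - exp (- \<delta> * (a - b))) * r + exp (- \<delta> * (a - b))"
    by (intro add_nonneg_nonneg mult_nonneg_nonneg) auto
  then have "0 \<le> r + exp (- \<delta> * (a - b)) * (1 - r)" by (simp add: algebra_simps)
  then show ?thesis using True \<open>0 \<le> W\<close> by simp
next
  case False
  define c where "c = exp (- \<delta> * (a - b))"
  define N where "N = L2norm \<pi> u'"
  have N: "N > 0" using False by (simp add: N_def less_le)
  have c: "0 \<le> c" "c \<le> 1" using \<delta>_pos ba by (auto simp: c_def)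
  have AP [measurable]: "A \<in> sets P" using A by (rule sets_filt_P)
  have u'm [measurable]: "u' \<in> borel_measurable \<pi>" and u'01: "0 \<le> u' x" "u' x \<le> 1" for x
    using u' by (auto simp: dens_def)
  have L': "L2 \<pi> u'" by (rule dens_L2[OF u'])
  have LU: "L2 P (\<lambda>\<omega>. u' (\<omega> b'))" by (rule L2_coord[OF L'])
  have NU: "L2norm P (\<lambda>\<omega>. u' (\<omega> b')) = N" unfolding N_def by (rule L2norm_coord[OF u'm])
  \<comment> \<open>Cutting with \<open>A\<close> gives two estimates: the integral of
    \<open>Y\<close> is at most \<open>sqrt (prob A) * N\<close> by Cauchy-Schwarz, and its norm at
    most \<open>N\<close>.\<close>
  define Y where "Y \<omega> = indicator A \<omega> * u' (\<omega> b')" for \<omega> :: "real \<Rightarrow> 's"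
  have Ym: "Y \<in> borel_measurable (filt {a..})"
    unfolding Y_def[abs_def]
    using A b' by (intro borel_measurable_times borel_measurable_indicator
        measurable_compose[OF measurable_coord_filt u'm]) auto
  have YL: "L2 P Y"
    by (rule L2_bounded[where B=1])
      (use measurable_filt_P[OF Ym] u'01 in \<open>auto simp: Y_def indicator_def\<close>)
  have Yint: "(\<integral>\<omega>. Y \<omega> \<partial>P) \<le> sqrt (prob A) * N"
    using ip_le_norms[OF L2_indicator[OF AP] LU] L2norm_indicator[OF AP] NU
    by (simp add: ip_def Y_def)
  have Y0: "0 \<le> (\<integral>\<omega>. Y \<omega> \<partial>P)"
    using u'01 by (intro Bochner_Integration.integral_nonneg) (simp add: Y_def)
  have YN: "L2norm P Y \<le> N"
    unfolding NU[symmetric] L2norm_def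
  proof (intro real_sqrt_le_mono integral_mono)
    show "(Y \<omega>)^2 \<le> (u' (\<omega> b'))^2" for \<omega> by (simp add: Y_def indicator_def)
  qed (use YL LU in \<open>auto simp: L2_def\<close>)
  have W0: "0 \<le> W" using W(3) L2norm_nonneg[of \<pi> u] by linarith
  have "N * N = ip \<pi> u' u'" unfolding N_def by (metis L2norm_sq power2_eq_square)
  also have "\<dots> = (\<integral>\<omega>. indicator (E \<inter> A) \<omega> * u' (\<omega> b') \<partial>P)"
    by (rule densD[OF u' u'm, symmetric])
  also have "\<dots> = (\<integral>\<omega>. indicator E \<omega> * Y \<omega> \<partial>P)"
    by (simp add: indicator_inter_arith Y_def mult.assoc)
  also have "\<dots> \<le> W * ((1 - c) * s * (\<integral>\<omega>. Y \<omega> \<partial>P) + c * L2norm P Y)"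
    unfolding c_def by (rule mixing_event[OF E ba u Ym YL Y0 W(2,3)])
  also have "\<dots> \<le> W * ((1 - c) * s * (sqrt (prob A) * N) + c * N)"
    using c W(1) W0 Yint YN by (intro mult_left_mono add_mono) auto
  also have "\<dots> = W * (r + c * (1 - r)) * N"
    unfolding r_def by (simp add: algebra_simps)
  finally show ?thesis using N unfolding c_def N_def by simp
qed

text \<open>Stated with half-lines, so only the ends facing a gap occur and infinite outer ends
  cause no trouble. Inner windows may degenerate to a point, as happens in the recurrence bound when
  its window does.\<close>

lemma chain_bound:
  fixes a b :: "nat \<Rightarrow> real"
  assumes past: "\<And>i. i < k \<Longrightarrow> A i \<in> sets (filt {..b i})"
    and future: "\<And>i. i < k \<Longrightarrow> A (Suc i) \<in> sets (filt {a (Suc i)..})"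
    and ba: "\<And>i. i < k \<Longrightarrow> b i \<le> a (Suc i)"
    and ab: "\<And>i. Suc i < k \<Longrightarrow> a (Suc i) \<le> b (Suc i)"
    and k: "1 \<le> k"
  shows "prob (\<Inter>i\<in>{0..k}. A i) \<le> sqrt (prob (A 0)) * sqrt (prob (A k))
    * (\<Prod>i<k. sqrt (prob (A i)) * sqrt (prob (A (Suc i)))
         + exp (- \<delta> * (a (Suc i) - b i)) * (1 - sqrt (prob (A i)) * sqrt (prob (A (Suc i)))))"
proof -
  define E where "E i = (\<Inter>j\<in>{0..i}. A j)" for i
  define R where "R i = sqrt (prob (A i)) * sqrt (prob (A (Suc i)))
    + exp (- \<delta> * (a (Suc i) - b i)) * (1 - sqrt (prob (A i)) * sqrt (prob (A (Suc i))))" for i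
  define W where "W i = sqrt (prob (A 0)) * (\<Prod>j<i. R j)" for i
  have E_Suc: "E (Suc i) = E i \<inter> A (Suc i)" for i
    unfolding E_def by (auto simp: atLeastAtMostSuc_conv)
  have W_Suc: "W (Suc i) = W i * R i" for i
    unfolding W_def by (simp add: mult.assoc)
  have inv: "E i \<in> sets (filt {..b i}) \<and> prob (E i) \<le> sqrt (prob (A i)) * W i
      \<and> (\<exists>u. dens (b i) (E i) u \<and> L2norm \<pi> u \<le> W i)" if "i < k" for i
    using that
  proof (induction i)
    case 0
    have E0: "E 0 = A 0" by (simp add: E_def)
    have A0: "A 0 \<in> sets (filt {..b 0})" by (rule past[OF 0])
    then have AP: "A 0 \<in> sets P" by (rule sets_filt_P)
    obtain u where u: "dens (b 0) (A 0) u" using dens_exists[OF AP] by blast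
    have L: "L2 \<pi> u" by (rule dens_L2[OF u])
    \<comment> \<open>The first density is a conditional expectation of an indicator, so
      Cauchy-Schwarz on path space bounds its norm.\<close>
    have "L2norm \<pi> u \<le> sqrt (prob (A 0))"
    proof (rule L2norm_le_dual[OF L])
      fix f assume f: "L2 \<pi> f"
      have "ip \<pi> u f = ip P (indicator (A 0)) (\<lambda>\<omega>. f (\<omega> (b 0)))"
        using densD[OF u L2_meas[OF f]] by (simp add: ip_def)
      also have "\<dots> \<le> L2norm P (indicator (A 0)) * L2norm P (\<lambda>\<omega>. f (\<omega> (b 0)))"
        by (intro ip_le_norms L2_indicator AP L2_coord f)
      also have "\<dots> = sqrt (prob (A 0)) * L2norm \<pi> f"
        by (simp only: L2norm_indicator[OF AP] L2norm_coord[OF L2_meas[OF f]])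
      finally show "ip \<pi> u f \<le> sqrt (prob (A 0)) * L2norm \<pi> f" .
    qed simp
    then show ?case using u A0 unfolding E0 by (auto simp: W_def)
  next
    case (Suc i)
    then have i: "i < k" and IH: "E i \<in> sets (filt {..b i})" "prob (E i) \<le> sqrt (prob (A i)) * W i"
      by auto
    obtain u where u: "dens (b i) (E i) u" "L2norm \<pi> u \<le> W i" using Suc by auto
    have le: "b i \<le> a (Suc i)" "a (Suc i) \<le> b (Suc i)" using ba[OF i] ab[OF Suc.prems] by auto
    have E': "E (Suc i) \<in> sets (filt {..b (Suc i)})"
      unfolding E_Suc using IH(1) past[OF Suc.prems] filt_mono[of "{..b i}" "{..b (Suc i)}"] le
      by (intro sets.Int) auto
    obtain u' where u': "dens (b (Suc i)) (E i \<inter> A (Suc i)) u'"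
      using dens_exists[OF sets_filt_P[OF E']] unfolding E_Suc by blast
    have "L2norm \<pi> u' \<le> W (Suc i)"
      unfolding W_Suc R_def
      by (rule step_dens[OF IH(1) le(1) u(1) future[OF i] _ IH(2) u(2) le(2) u']) simp
    moreover have "prob (E (Suc i)) \<le> sqrt (prob (A (Suc i))) * W (Suc i)"
      unfolding W_Suc R_def E_Suc
      by (rule step_prob[OF IH(1) le(1) u(1) future[OF i] IH(2) u(2)])
    ultimately show ?case using E' u' unfolding E_Suc by blast
  qed
  obtain i where i: "k = Suc i" using k by (cases k) auto
  then have ik: "i < k" by simp
  obtain u where u: "dens (b i) (E i) u" "L2norm \<pi> u \<le> W i" using inv[OF ik] by blast
  \<comment> \<open>The last step needs only a probability, which requires no right end for the
    final window.\<close>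
  have "prob (E k) \<le> sqrt (prob (A k)) * W k"
    unfolding i W_Suc R_def E_Suc
    using inv[OF ik] future[OF ik] by (intro step_prob[OF _ ba[OF ik] u(1) _ _ u(2)]) auto
  then show ?thesis
    unfolding E_def W_def R_def by (simp add: mult_ac)
qed

section \<open>Time shifts, extended endpoints and recurrence\<close>

lemma measurable_shift: "(\<lambda>\<omega> t. \<omega> (t + s)) \<in> measurable P P"
proof -
  have "(\<lambda>\<omega> t. \<omega> (t + s)) \<in> measurable P (path_space \<pi>)"
    by (rule measurable_PiM_single') (auto simp: space_P)
  then show ?thesis by (simp add: measurable_cong_sets[OF refl sets_P])
qed

lemma prob_shift:
  assumes "A \<in> sets P"
  shows "prob {\<omega> \<in> space P. (\<lambda>t. \<omega> (t + s)) \<in> A} = prob A"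
proof -
  have "prob A = measure (distr P P (\<lambda>\<omega> t. \<omega> (t + s))) A"
    using stationary_P by (simp add: stationary_def)
  also have "\<dots> = prob ((\<lambda>\<omega> t. \<omega> (t + s)) -` A \<inter> space P)"
    by (rule measure_distr[OF measurable_shift assms])
  finally show ?thesis by (simp add: vimage_def Int_def conj_commute)
qed

lemma filt_shift:
  assumes A: "A \<in> sets (filt I)" and IJ: "\<And>t. t \<in> I \<Longrightarrow> t + s \<in> J"
  shows "{\<omega> \<in> space P. (\<lambda>t. \<omega> (t + s)) \<in> A} \<in> sets (filt J)"
proof -
  have "(\<lambda>\<omega> t. \<omega> (t + s)) \<in> measurable (filt J) (filt I)"
    unfolding filt_def[of I]
  proof (rule measurable_measure_of[OF filt_gen_Pow])
    show "(\<lambda>\<omega> t. \<omega> (t + s)) \<in> space (filt J) \<rightarrow> space P" by (auto simp: space_P)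
    fix y assume "y \<in> (\<Union>t\<in>I. {(\<lambda>\<omega>. \<omega> t) -` B \<inter> space P |B. B \<in> sets \<pi>})"
    then obtain t B where t: "t \<in> I" and B: "B \<in> sets \<pi>" and y: "y = (\<lambda>\<omega>. \<omega> t) -` B \<inter> space P" by blast
    have "(\<lambda>\<omega> t. \<omega> (t + s)) -` y \<inter> space (filt J) = (\<lambda>\<omega>. \<omega> (t + s)) -` B \<inter> space (filt J)"
      unfolding y by (auto simp: space_P)
    also have "\<dots> \<in> sets (filt J)"
      by (rule measurable_sets[OF measurable_coord_filt[OF IJ[OF t]] B])
    finally show "(\<lambda>\<omega> t. \<omega> (t + s)) -` y \<inter> space (filt J) \<in> sets (filt J)" .
  qed
  from measurable_sets[OF this A] show ?thesis
    by (simp add: vimage_def Int_def conj_commute)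
qed

lemma ereal_chain_bound:
  fixes a b :: "nat \<Rightarrow> ereal"
  assumes k: "1 \<le> k" and ab: "\<And>i. i \<le> k \<Longrightarrow> a i < b i" and ba: "\<And>i. i < k \<Longrightarrow> b i \<le> a (Suc i)"
    and A: "\<And>i. i \<le> k \<Longrightarrow> A i \<in> sets (filt {t. a i \<le> ereal t \<and> ereal t \<le> b i})"
  shows "prob (\<Inter>i\<in>{0..k}. A i) \<le> sqrt (prob (A 0)) * sqrt (prob (A k))
    * (\<Prod>i<k. sqrt (prob (A i)) * sqrt (prob (A (Suc i)))
         + exp (- \<delta> * real_of_ereal (a (Suc i) - b i)) * (1 - sqrt (prob (A i)) * sqrt (prob (A (Suc i)))))"
proof -
  define a' where "a' i = real_of_ereal (a i)" for i
  define b' where "b' i = real_of_ereal (b i)" for i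
  have b': "b i = ereal (b' i)" and a': "a (Suc i) = ereal (a' (Suc i))" if "i < k" for i
  proof -
    have *: "a i < b i" "b i \<le> a (Suc i)" "a (Suc i) < b (Suc i)"
      using ab[of i] ab[of "Suc i"] ba[OF that] that by auto
    \<comment> \<open>\<open>b i\<close> exceeds \<open>a i\<close>, hence is not minus infinity;
      \<open>a (Suc i)\<close> is below \<open>b (Suc i)\<close>, hence not infinity;
      \<open>b i \<le> a (Suc i)\<close> makes both finite.\<close>
    have "\<bar>b i\<bar> \<noteq> \<infinity>" using * by (cases "b i"; cases "a (Suc i)") auto
    then show "b i = ereal (b' i)" by (simp add: b'_def ereal_real)
    have "\<bar>a (Suc i)\<bar> \<noteq> \<infinity>" using * by (cases "b i"; cases "a (Suc i)") auto
    then show "a (Suc i) = ereal (a' (Suc i))" by (simp add: a'_def ereal_real)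
  qed
  have "prob (\<Inter>i\<in>{0..k}. A i) \<le> sqrt (prob (A 0)) * sqrt (prob (A k))
    * (\<Prod>i<k. sqrt (prob (A i)) * sqrt (prob (A (Suc i)))
         + exp (- \<delta> * (a' (Suc i) - b' i)) * (1 - sqrt (prob (A i)) * sqrt (prob (A (Suc i)))))"
  proof (rule chain_bound[OF _ _ _ _ k])
    fix i assume i: "i < k"
    have "{t. a i \<le> ereal t \<and> ereal t \<le> b i} \<subseteq> {..b' i}"
      using b'[OF i] by auto
    from filt_mono[OF this] show "A i \<in> sets (filt {..b' i})" using A[of i] i by (auto simp: subset_iff)
    have "{t. a (Suc i) \<le> ereal t \<and> ereal t \<le> b (Suc i)} \<subseteq> {a' (Suc i)..}"
      using a'[OF i] by auto
    from filt_mono[OF this] show "A (Suc i) \<in> sets (filt {a' (Suc i)..})" using A[of "Suc i"] i by (auto simp: subset_iff)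
    show "b' i \<le> a' (Suc i)" using ba[OF i] a'[OF i] b'[OF i] by simp
  next
    fix i assume i: "Suc i < k"
    then have "i < k" by simp
    then show "a' (Suc i) \<le> b' (Suc i)"
      using ab[of "Suc i"] a'[of i] b'[OF i] i by simp
  qed
  also have "(\<Prod>i<k. sqrt (prob (A i)) * sqrt (prob (A (Suc i)))
         + exp (- \<delta> * (a' (Suc i) - b' i)) * (1 - sqrt (prob (A i)) * sqrt (prob (A (Suc i)))))
     = (\<Prod>i<k. sqrt (prob (A i)) * sqrt (prob (A (Suc i)))
         + exp (- \<delta> * real_of_ereal (a (Suc i) - b i)) * (1 - sqrt (prob (A i)) * sqrt (prob (A (Suc i)))))"
    by (rule prod.cong) (simp_all add: a' b')
  finally show ?thesis .
qed

text \<open>The shifted events live on the windows from \<open>a + s i\<close> to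
  \<open>b + s i\<close>, whose gaps are the given differences; by stationarity all have the
  probability of \<open>A\<close>, so each product of two roots collapses to
  \<open>prob A\<close>.\<close>

lemma recurrence_bound:
  fixes s :: "nat \<Rightarrow> real"
  assumes k: "1 \<le> k" and ab: "a \<le> b" and A: "A \<in> sets (filt {a..b})"
    and gap: "\<And>i. i < k \<Longrightarrow> 0 \<le> s (Suc i) - s i - (b - a)"
  shows "prob {\<omega> \<in> space P. \<forall>i\<le>k. (\<lambda>t. \<omega> (t + s i)) \<in> A}
    \<le> prob A * (\<Prod>i<k. prob A + exp (- \<delta> * (s (Suc i) - s i - (b - a))) * (1 - prob A))"
proof -
  define B where "B i = {\<omega> \<in> space P. (\<lambda>t. \<omega> (t + s i)) \<in> A}" for i
  have pB: "prob (B i) = prob A" for i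
    unfolding B_def by (rule prob_shift[OF sets_filt_P[OF A]])
  have "prob (\<Inter>i\<in>{0..k}. B i) \<le> sqrt (prob (B 0)) * sqrt (prob (B k))
    * (\<Prod>i<k. sqrt (prob (B i)) * sqrt (prob (B (Suc i)))
         + exp (- \<delta> * ((a + s (Suc i)) - (b + s i))) * (1 - sqrt (prob (B i)) * sqrt (prob (B (Suc i)))))"
  proof (rule chain_bound[OF _ _ _ _ k])
    fix i assume i: "i < k"
    show "B i \<in> sets (filt {..b + s i})" unfolding B_def by (rule filt_shift[OF A]) auto
    show "B (Suc i) \<in> sets (filt {a + s (Suc i)..})" unfolding B_def by (rule filt_shift[OF A]) auto
    show "b + s i \<le> a + s (Suc i)" using gap[OF i] by simp
  qed (use ab in simp)
  moreover have "(\<Inter>i\<in>{0..k}. B i) = {\<omega> \<in> space P. \<forall>i\<le>k. (\<lambda>t. \<omega> (t + s i)) \<in> A}"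
    unfolding B_def by auto
  ultimately show ?thesis by (simp add: pB algebra_simps)
qed

end

theorem theorem1p2:
  fixes \<pi> :: "'s measure" and P :: "(real \<Rightarrow> 's) measure"
    and T :: "real \<Rightarrow> ('s \<Rightarrow> real) \<Rightarrow> ('s \<Rightarrow> real)" and \<delta> :: real
  assumes "prob_space \<pi>"
    and "prob_space P"
    and "sets P = sets (path_space \<pi>)"
    and "stationary P \<pi>"
    and "markov P \<pi> T"
    and "symmetric_C0 \<pi> T"
    and "\<delta> > 0"
    and "spectral_gap \<pi> T \<delta>"
  shows "(\<forall>(k::nat) (a::nat \<Rightarrow> ereal) (b::nat \<Rightarrow> ereal) (A::nat \<Rightarrow> (real \<Rightarrow> 's) set).
            1 \<le> k
            \<longrightarrow> (\<forall>i\<le>k. a i < b i)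
            \<longrightarrow> (\<forall>i<k. b i \<le> a (Suc i))
            \<longrightarrow> (\<forall>i\<le>k. A i \<in> coord_sigma P \<pi> {t. a i \<le> ereal t \<and> ereal t \<le> b i})
            \<longrightarrow> measure P (\<Inter>i\<in>{0..k}. A i)
                \<le> sqrt (measure P (A 0)) * sqrt (measure P (A k))
                   * (\<Prod>i<k. sqrt (measure P (A i)) * sqrt (measure P (A (Suc i)))
                        + exp (- \<delta> * real_of_ereal (a (Suc i) - b i))
                          * (1 - sqrt (measure P (A i)) * sqrt (measure P (A (Suc i))))))
       \<and> (\<forall>(k::nat) (s::nat \<Rightarrow> real) (a::real) (b::real) (A::(real \<Rightarrow> 's) set) (p::real).
            1 \<le> k
            \<longrightarrow> a \<le> b
            \<longrightarrow> A \<in> coord_sigma P \<pi> {a..b}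
            \<longrightarrow> measure P A = p
            \<longrightarrow> (\<forall>i<k. s i < s (Suc i))
            \<longrightarrow> (\<forall>i<k. s (Suc i) - s i - (b - a) \<ge> 0)
            \<longrightarrow> measure P {\<omega>\<in>space P. \<forall>i\<le>k. (\<lambda>t. \<omega> (t + s i)) \<in> A}
                \<le> p * (\<Prod>i<k. p + exp (- \<delta> * (s (Suc i) - s i - (b - a))) * (1 - p)))"
proof -
  interpret gapped_markov P \<pi> T \<delta>
    using assms by (simp add: gapped_markov_def gapped_markov_axioms_def
        reversible_markov_def reversible_markov_axioms_def)
  show ?thesis
  proof (intro conjI allI impI)
    fix k :: nat and a b :: "nat \<Rightarrow> ereal" and A :: "nat \<Rightarrow> (real \<Rightarrow> 's) set"
    assume "1 \<le> k" "\<forall>i\<le>k. a i < b i" "\<forall>i<k. b i \<le> a (Suc i)"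
      "\<forall>i\<le>k. A i \<in> coord_sigma P \<pi> {t. a i \<le> ereal t \<and> ereal t \<le> b i}"
    then show "measure P (\<Inter>i\<in>{0..k}. A i)
                \<le> sqrt (measure P (A 0)) * sqrt (measure P (A k))
                   * (\<Prod>i<k. sqrt (measure P (A i)) * sqrt (measure P (A (Suc i)))
                        + exp (- \<delta> * real_of_ereal (a (Suc i) - b i))
                          * (1 - sqrt (measure P (A i)) * sqrt (measure P (A (Suc i)))))"
      by (intro ereal_chain_bound) (auto simp: sets_filt)
  next
    fix k :: nat and s :: "nat \<Rightarrow> real" and a b :: real and A :: "(real \<Rightarrow> 's) set" and p :: real
    assume "1 \<le> k" "a \<le> b" "A \<in> coord_sigma P \<pi> {a..b}" "measure P A = p"
      "\<forall>i<k. s i < s (Suc i)" "\<forall>i<k. s (Suc i) - s i - (b - a) \<ge> 0"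
    then show "measure P {\<omega>\<in>space P. \<forall>i\<le>k. (\<lambda>t. \<omega> (t + s i)) \<in> A}
                \<le> p * (\<Prod>i<k. p + exp (- \<delta> * (s (Suc i) - s i - (b - a))) * (1 - p))"
      using recurrence_bound[of k a b A s] by (simp add: sets_filt)
  qed
qed

end
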